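(* Let $0<s\le1$. For $0\le n\le M-1$ let $Z^{n,1}\in S_N$ be defined by one step of the implicit midpoint rule from the semidiscrete solution, $$Z^{n,1}=u^N(t_n)+kF\Big(\frac{Z^{n,1}+u^N(t_n)}2\Big),$$ and let $\Theta^n=u^N(t_{n+1})-Z^{n,1}$. Let $u$ be the solution of the periodic problem $iu_t-(-\partial_{xx})^su+|u|^2u=0$, $u(x,0)=u_0(x)$, and assume that $u\in H^\mu$ for $0\le t\le T$ and $\mu$ large enough. Then, for $k$ small enough (with $3\|P_Nu_0\|^2kN<1$), there is a constant $C$, independent of $k$ and $N$, such that $$\max_{0\le n\le M-1}\|\Theta^n\|\le Ck^3 .$$
   Context: $T>0$ fixed; $u_0$ is smooth and $2\pi$-periodic. Functions are complex-valued, $2\pi$-periodic in $x$; $\|\cdot\|$ is the norm of $L^2(-\pi,\pi)$. $\widehat u(k)=\frac1{2\pi}\int_{-\pi}^{\pi}u(x)e^{-ikx}dx$; $H^\mu$ has norm $\|u\|_\mu=(\sum_{k\in\mathbb Z}(1+k^2)^\mu|\widehat u(k)|^2)^{1/2}$; "$u\in H^\mu$ for $0\le t\le T$" means with norm bounded on $[0,T]$. $(-\partial_{xx})^s$ has Fourier symbol $|k|^{2s}$. $N\ge1$ is an integer, $S_N=\mathrm{span}\{e^{ikx}:-N\le k\le N\}$, $P_Nu=\sum_{|k|\le N}\widehat u(k)e^{ikx}$, and $F:S_N\to S_N$, $F(u)=-i(-\partial_{xx})^su+iP_N(|u|^2u)$. The semidiscrete solution $u^N$ with values in $S_N$ solves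 $\frac{d}{dt}u^N=F(u^N)$, $u^N(0)=P_Nu_0$. $k>0$ is the time step, $M$ an integer with $T=Mk$, $t_n=nk$. If needed, $u$ and $u^N$ are understood as extended to $[-k,T+k]$ with the same properties. *)

theory Defs
  imports "HOL-Analysis.Analysis"
begin

text \<open>Functions of \<open>x\<close> have type \<^typ>\<open>real \<Rightarrow> complex\<close>; periodicity is a predicate.\<close>

abbreviation periodic_2pi :: "(real \<Rightarrow> complex) \<Rightarrow> bool" where
  "periodic_2pi f \<equiv> periodic_fun_simple f (2 * pi)"

definition smooth :: "(real \<Rightarrow> complex) \<Rightarrow> bool" where
  "smooth f \<longleftrightarrow>
     (\<forall>n x. ((\<lambda>g y. vector_derivative g (at y)) ^^ n) f differentiable (at x))"

definition square_integrable :: "(real \<Rightarrow> complex) \<Rightarrow> bool" where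
  "square_integrable f \<longleftrightarrow>
     set_borel_measurable lebesgue {-pi..pi} f \<and>
     set_integrable lebesgue {-pi..pi} (\<lambda>x. (cmod (f x))\<^sup>2)"

text \<open>The \<open>L\<^sup>2(-\<pi>, \<pi>)\<close> norm carries no normalising factor, unlike the Fourier coefficients.\<close>

definition L2norm :: "(real \<Rightarrow> complex) \<Rightarrow> real" where
  "L2norm f = sqrt (LINT x:{-pi..pi}|lebesgue. (cmod (f x))\<^sup>2)"

definition fourier_coeff :: "(real \<Rightarrow> complex) \<Rightarrow> int \<Rightarrow> complex" where
  "fourier_coeff f j =
     (1 / (2 * pi)) *\<^sub>R (LINT x:{-pi..pi}|lebesgue. f x * cis (- (of_int j * x)))"

definition sobolev_space :: "real \<Rightarrow> (real \<Rightarrow> complex) set" where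
  "sobolev_space \<mu> =
     {f. periodic_2pi f \<and> square_integrable f \<and>
         (\<lambda>j::int. (1 + (of_int j)\<^sup>2) powr \<mu> * (cmod (fourier_coeff f j))\<^sup>2) summable_on UNIV}"

definition sobolev_norm :: "real \<Rightarrow> (real \<Rightarrow> complex) \<Rightarrow> real" where
  "sobolev_norm \<mu> f =
     sqrt (\<Sum>\<^sub>\<infinity>j::int. (1 + (of_int j)\<^sup>2) powr \<mu> * (cmod (fourier_coeff f j))\<^sup>2)"

text \<open>
  \<open>(-\<partial>\<^sub>x\<^sub>x)\<^sup>s\<close>, the multiplier with symbol \<open>|j|\<^sup>2\<^sup>s\<close>. For \<open>j = 0\<close> the symbol is \<open>0\<close>, as
  \<open>0 powr a = 0\<close>. The series is summed unconditionally; it is meaningful whenever it converges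
  absolutely, in particular on \<open>sobolev_space \<mu>\<close> for \<open>\<mu> > 2s + 1/2\<close>.
\<close>

definition frac_laplacian :: "real \<Rightarrow> (real \<Rightarrow> complex) \<Rightarrow> real \<Rightarrow> complex" where
  "frac_laplacian s f x =
     (\<Sum>\<^sub>\<infinity>j::int. of_real (\<bar>of_int j\<bar> powr (2 * s)) * fourier_coeff f j * cis (of_int j * x))"

definition trig_polys :: "nat \<Rightarrow> (real \<Rightarrow> complex) set" where
  "trig_polys N = {f. \<exists>c. f = (\<lambda>x. \<Sum>j\<in>{- int N..int N}. c j * cis (of_int j * x))}"

definition fourier_proj :: "nat \<Rightarrow> (real \<Rightarrow> complex) \<Rightarrow> real \<Rightarrow> complex" where
  "fourier_proj N f x = (\<Sum>j\<in>{- int N..int N}. fourier_coeff f j * cis (of_int j * x))"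

text \<open>
  A solution on \<open>[0, T]\<close> of \<open>i u\<^sub>t - (-\<partial>\<^sub>x\<^sub>x)\<^sup>s u + |u|\<^sup>2 u = 0\<close>, \<open>u(x, 0) = u\<^sub>0(x)\<close>. The time
  variable is the first argument of \<open>u\<close>; derivatives at the end points of \<open>[0, T]\<close> are one-sided.
  The equation is required pointwise, which is the usual sense for \<open>H\<^sup>\<mu>\<close> solutions with \<open>\<mu>\<close>
  large; continuity in \<open>x\<close> selects the continuous representative.
\<close>

definition fnls_solution ::
  "real \<Rightarrow> real \<Rightarrow> (real \<Rightarrow> complex) \<Rightarrow> (real \<Rightarrow> real \<Rightarrow> complex) \<Rightarrow> bool" where
  "fnls_solution s T u0 u \<longleftrightarrow>
     (\<forall>t\<in>{0..T}. periodic_2pi (u t) \<and> continuous_on UNIV (u t)) \<and>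
     (\<forall>t\<in>{0..T}. \<forall>x. \<exists>d.
        ((\<lambda>\<tau>. u \<tau> x) has_vector_derivative d) (at t within {0..T}) \<and>
        \<i> * d - frac_laplacian s (u t) x + of_real ((cmod (u t x))\<^sup>2) * u t x = 0) \<and>
     u 0 = u0"

definition semidiscrete_rhs :: "real \<Rightarrow> nat \<Rightarrow> (real \<Rightarrow> complex) \<Rightarrow> real \<Rightarrow> complex" where
  "semidiscrete_rhs s N f x =
     - \<i> * frac_laplacian s f x
     + \<i> * fourier_proj N (\<lambda>y. of_real ((cmod (f y))\<^sup>2) * f y) x"

text \<open>
  For curves in the finite-dimensional space \<open>trig_polys N\<close>, differentiability in \<open>t\<close> at each fixed
  \<open>x\<close> is the same as differentiability in norm.
\<close>

definition semidiscrete_solution ::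
  "real \<Rightarrow> nat \<Rightarrow> real \<Rightarrow> (real \<Rightarrow> complex) \<Rightarrow> (real \<Rightarrow> real \<Rightarrow> complex) \<Rightarrow> bool" where
  "semidiscrete_solution s N T u0 uN \<longleftrightarrow>
     (\<forall>t\<in>{0..T}. uN t \<in> trig_polys N) \<and>
     (\<forall>t\<in>{0..T}. \<forall>x.
        ((\<lambda>\<tau>. uN \<tau> x) has_vector_derivative semidiscrete_rhs s N (uN t) x)
          (at t within {0..T})) \<and>
     uN 0 = fourier_proj N u0"

definition midpoint_step ::
  "real \<Rightarrow> nat \<Rightarrow> real \<Rightarrow> (real \<Rightarrow> complex) \<Rightarrow> (real \<Rightarrow> complex) \<Rightarrow> bool" where
  "midpoint_step s N k v z \<longleftrightarrow>
     z \<in> trig_polys N \<and>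
     (\<forall>x. z x = v x + of_real k * semidiscrete_rhs s N (\<lambda>y. (z y + v y) / 2) x)"

end

theory Submission
  imports Defs
begin

text \<open>
  The constant must not depend on \<open>N\<close>, so the Fourier coefficients of \<open>u\<^sup>N(t)\<close> are first shown to
  be bounded by \<open>K (1 + |j|)\<^bsup>-8\<^esup>\<close> uniformly in \<open>N\<close> and \<open>t\<close>. There is no a priori bound for this,
  and it is inherited from \<open>u\<close>: the energy \<open>y\<close> of \<open>e = P\<^sub>N u - u\<^sup>N\<close> satisfies \<open>y' \<le> K (y + \<tau>\<^sup>2)\<close>
  as long as \<open>(2 N + 1) y < 1\<close>, where the truncation error \<open>\<tau>\<close> is \<open>O(N\<^bsup>-8\<^esup>)\<close>. Gronwall's
  inequality and a continuation argument give \<open>y = O(N\<^bsup>-16\<^esup>)\<close> for large \<open>N\<close>, hence the decay of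
  the coefficients; for the finitely many small \<open>N\<close> it follows from conservation of mass.
  Each time derivative costs two powers of \<open>1 + |j|\<close>, and weighted sup norms of
  coefficients are stable under the cubic convolution, so three time derivatives of \<open>u\<^sup>N\<close> are
  bounded in \<open>L\<^sup>2\<close>.

  Consequently \<open>u\<^sup>N\<close> satisfies the trapezoidal rule up to \<open>O(k\<^sup>3)\<close>. Trapezoidal and midpoint rule
  agree on the linear term and differ by \<open>O(k\<^sup>2)\<close> on the cubic one. The difference
  \<open>\<Theta> = u\<^sup>N(t\<^sub>n\<^sub>+\<^sub>1) - Z\<close> is then estimated by fourier_coeff_pairing its equation with \<open>\<Theta>\<close>: the midpoint rule
  conserves mass, so \<open>|v|\<^sup>2 \<le> (2 N + 1) / (2 \<pi>) \<parallel>P\<^sub>N u\<^sub>0\<parallel>\<^sup>2\<close> for the averages \<open>v\<close> involved, and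
  the step size restriction allows the Lipschitz term to be absorbed.
\<close>

section \<open>Trigonometric polynomials\<close>

definition trig_poly :: "nat \<Rightarrow> (int \<Rightarrow> complex) \<Rightarrow> real \<Rightarrow> complex" where
  "trig_poly N c x = (\<Sum>j\<in>{- int N..int N}. c j * cis (of_int j * x))"

lemma trig_polys_iff: "f \<in> trig_polys N \<longleftrightarrow> (\<exists>c. f = trig_poly N c)"
  unfolding trig_polys_def trig_poly_def by (auto simp: fun_eq_iff)

lemma fourier_proj_eq: "fourier_proj N f = trig_poly N (fourier_coeff f)"
  by (auto simp: fourier_proj_def trig_poly_def)

lemma continuous_trig_poly [continuous_intros]: "continuous_on A (trig_poly N c)"
  unfolding trig_poly_def by (intro continuous_intros)

section \<open>Fourier coefficients of continuous functions and orthogonality\<close>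

lemma LINT_eq_integral:
  fixes f :: "real \<Rightarrow> 'a::euclidean_space"
  assumes "continuous_on {-pi..pi} f"
  shows "(LINT x:{-pi..pi}|lebesgue. f x) = integral {-pi..pi} f"
  by (rule set_lebesgue_integral_eq_integral(2)[OF absolutely_integrable_continuous_real[OF assms]])

lemma fourier_coeff_integral:
  assumes "continuous_on {-pi..pi} f"
  shows "fourier_coeff f j = (1 / (2 * pi)) *\<^sub>R integral {-pi..pi} (\<lambda>x. f x * cis (- (of_int j * x)))"
  unfolding fourier_coeff_def
  by (subst LINT_eq_integral) (intro continuous_intros assms | simp)+

lemma integrable_on_continuous_UNIV [intro]:
  fixes f :: "real \<Rightarrow> 'a::euclidean_space"
  shows "continuous_on UNIV f \<Longrightarrow> f integrable_on {a..b}"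
  by (meson continuous_on_subset integrable_continuous_real top_greatest)

lemma fourier_coeff_add:
  assumes "continuous_on UNIV f" "continuous_on UNIV g"
  shows "fourier_coeff (\<lambda>x. f x + g x) j = fourier_coeff f j + fourier_coeff g j"
proof -
  have "fourier_coeff (\<lambda>x. f x + g x) j = (1 / (2 * pi)) *\<^sub>R integral {-pi..pi}
      (\<lambda>x. f x * cis (- (of_int j * x)) + g x * cis (- (of_int j * x)))"
    by (subst fourier_coeff_integral)
      (auto simp: distrib_right intro!: continuous_intros continuous_on_subset[OF assms(1)] continuous_on_subset[OF assms(2)])
  also have "\<dots> = fourier_coeff f j + fourier_coeff g j"
    by (subst integral_add)
      (auto simp: fourier_coeff_integral scaleR_add_right continuous_on_subset[OF assms(1)] continuous_on_subset[OF assms(2)] intro!: continuous_intros assms)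
  finally show ?thesis .
qed

lemma fourier_coeff_mult_left:
  assumes "continuous_on UNIV f"
  shows "fourier_coeff (\<lambda>x. c * f x) j = c * fourier_coeff f j"
proof -
  have "continuous_on {-pi..pi} f" using assms continuous_on_subset by blast
  thus ?thesis
    by (simp add: fourier_coeff_integral continuous_on_mult_left mult.assoc)
qed

lemma fourier_coeff_sum:
  assumes "finite A" "\<And>i. i \<in> A \<Longrightarrow> continuous_on UNIV (f i)"
  shows "fourier_coeff (\<lambda>x. \<Sum>i\<in>A. f i x) j = (\<Sum>i\<in>A. fourier_coeff (f i) j)"
  using assms
proof (induction A rule: finite_induct)
  case empty
  show ?case by (simp add: fourier_coeff_def set_lebesgue_integral_def)
next
  case (insert a A)
  then show ?case by (simp add: fourier_coeff_add continuous_on_sum)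
qed

lemma integral_cis:
  "integral {-pi..pi} (\<lambda>x. cis (of_int j * x)) = (if j = 0 then 2 * of_real pi else 0)"
proof (cases "j = 0")
  case False
  define F where "F = (\<lambda>x. cis (of_int j * x) / (\<i> * of_int j))"
  have "(F has_vector_derivative cis (of_int j * x)) (at x within {-pi..pi})" for x
    unfolding F_def cis_conv_exp using False
    by (auto intro!: derivative_eq_intros has_vector_derivative_real_field simp: field_simps)
  hence "((\<lambda>x. cis (of_int j * x)) has_integral (F pi - F (-pi))) {-pi..pi}"
    by (intro fundamental_theorem_of_calculus) auto
  moreover have "F pi = F (-pi)"
  proof -
    have "cis (of_int j * pi) = cis (- (of_int j * pi))"
      by (simp add: complex_eq_iff mult.commute sin_times_pi_eq_0)
    thus ?thesis by (simp add: F_def)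
  qed
  ultimately show ?thesis using False by (simp add: integral_unique)
qed (simp add: scaleR_conv_of_real)

lemma fourier_coeff_cis: "fourier_coeff (\<lambda>x. cis (of_int l * x)) j = of_bool (l = j)"
proof -
  have "fourier_coeff (\<lambda>x. cis (of_int l * x)) j =
      (1 / (2 * pi)) *\<^sub>R integral {-pi..pi} (\<lambda>x. cis (of_int (l - j) * x))"
    by (subst fourier_coeff_integral) (auto intro!: continuous_intros simp: cis_mult algebra_simps)
  thus ?thesis unfolding integral_cis by (auto simp: scaleR_conv_of_real)
qed

lemma fourier_coeff_trig_poly:
  "fourier_coeff (trig_poly N c) j = (if j \<in> {- int N..int N} then c j else 0)"
proof -
  have "fourier_coeff (trig_poly N c) j = (\<Sum>i\<in>{- int N..int N}. fourier_coeff (\<lambda>x. c i * cis (of_int i * x)) j)"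
    unfolding trig_poly_def by (rule fourier_coeff_sum) (auto intro!: continuous_intros)
  also have "\<dots> = (\<Sum>i\<in>{- int N..int N}. if i = j then c i else 0)"
    by (rule sum.cong) (auto simp: fourier_coeff_mult_left fourier_coeff_cis continuous_intros)
  finally show ?thesis by simp
qed

lemma trig_poly_cong: "(\<And>j. j \<in> {- int N..int N} \<Longrightarrow> c j = d j) \<Longrightarrow> trig_poly N c = trig_poly N d"
  by (auto simp: trig_poly_def intro!: sum.cong)

lemma trig_poly_fourier_coeff: "f \<in> trig_polys N \<Longrightarrow> f = trig_poly N (fourier_coeff f)"
  by (auto simp: trig_polys_iff fourier_coeff_trig_poly intro!: trig_poly_cong)

lemma trig_poly_add: "trig_poly N c x + trig_poly N d x = trig_poly N (\<lambda>j. c j + d j) x"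
  by (simp add: trig_poly_def sum.distrib distrib_right)

lemma trig_poly_diff: "trig_poly N c x - trig_poly N d x = trig_poly N (\<lambda>j. c j - d j) x"
  by (simp add: trig_poly_def sum_subtractf left_diff_distrib)

lemma trig_poly_mult: "a * trig_poly N c x = trig_poly N (\<lambda>j. a * c j) x"
  by (simp add: trig_poly_def sum_distrib_left mult.assoc)

lemma trig_poly_inject:
  assumes "\<And>x. trig_poly N c x = trig_poly N d x" "j \<in> {- int N..int N}"
  shows "c j = d j"
  using assms fourier_coeff_trig_poly[of N c j] fourier_coeff_trig_poly[of N d j]
  by (metis ext)

text \<open>A trigonometric polynomial of degree \<open>N\<close> tests \<open>h\<close> only on the
  frequencies up to \<open>N\<close>. The projection of the cubic term therefore disappears from
  every energy estimate, and pointwise bounds on the nonlinearity can be used instead.\<close>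

lemma fourier_coeff_pairing:
  assumes "continuous_on UNIV h"
  shows "(\<Sum>j\<in>{- int N..int N}. fourier_coeff h j * cnj (c j)) =
     (1 / (2 * pi)) *\<^sub>R integral {-pi..pi} (\<lambda>x. h x * cnj (trig_poly N c x))"
proof -
  have "integral {-pi..pi} (\<lambda>x. h x * cnj (trig_poly N c x)) =
     integral {-pi..pi} (\<lambda>x. \<Sum>j\<in>{- int N..int N}. cnj (c j) * (h x * cis (- (of_int j * x))))"
    by (simp add: trig_poly_def sum_distrib_left mult_ac cis_cnj)
  also have "\<dots> = (\<Sum>j\<in>{- int N..int N}. integral {-pi..pi} (\<lambda>x. cnj (c j) * (h x * cis (- (of_int j * x)))))"
    by (rule integral_sum) (auto intro!: continuous_intros assms)
  also have "\<dots> = (\<Sum>j\<in>{- int N..int N}. cnj (c j) * integral {-pi..pi} (\<lambda>x. h x * cis (- (of_int j * x))))"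
    by simp
  finally show ?thesis
    by (simp add: fourier_coeff_integral continuous_on_subset[OF assms] scaleR_sum_right mult.commute)
qed

lemma norm_fourier_coeff_pairing_le:
  assumes "continuous_on UNIV h" "\<And>x. cmod (h x) \<le> B x" "continuous_on UNIV B"
  shows "cmod (\<Sum>j\<in>{- int N..int N}. fourier_coeff h j * cnj (c j)) \<le>
     (1 / (2 * pi)) * integral {-pi..pi} (\<lambda>x. B x * cmod (trig_poly N c x))"
proof -
  have "cmod (integral {-pi..pi} (\<lambda>x. h x * cnj (trig_poly N c x))) \<le>
     integral {-pi..pi} (\<lambda>x. B x * cmod (trig_poly N c x))"
    by (rule integral_norm_bound_integral)
      (auto intro!: continuous_intros assms mult_right_mono simp: norm_mult)
  thus ?thesis unfolding fourier_coeff_pairing[OF assms(1)] by (simp add: divide_right_mono)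
qed

lemma parseval_trig_poly:
  "integral {-pi..pi} (\<lambda>x. (cmod (trig_poly N c x))\<^sup>2) = 2 * pi * (\<Sum>j\<in>{- int N..int N}. (cmod (c j))\<^sup>2)"
proof -
  have i: "(\<lambda>x. (cmod (trig_poly N c x))\<^sup>2) integrable_on {-pi..pi}"
    by (intro integrable_on_continuous_UNIV continuous_intros)
  have "complex_of_real (\<Sum>j\<in>{- int N..int N}. (cmod (c j))\<^sup>2) =
     (\<Sum>j\<in>{- int N..int N}. fourier_coeff (trig_poly N c) j * cnj (c j))"
    by (auto simp: fourier_coeff_trig_poly complex_norm_square[symmetric] intro!: sum.cong)
  also have "\<dots> = (1 / (2 * pi)) *\<^sub>R integral {-pi..pi} (\<lambda>x. of_real ((cmod (trig_poly N c x))\<^sup>2))"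
    by (subst fourier_coeff_pairing) (auto intro!: continuous_intros simp: complex_norm_square[symmetric])
  also have "integral {-pi..pi} (\<lambda>x. complex_of_real ((cmod (trig_poly N c x))\<^sup>2)) =
       of_real (integral {-pi..pi} (\<lambda>x. (cmod (trig_poly N c x))\<^sup>2))"
    using integral_linear[OF i bounded_linear_of_real] by (simp add: o_def)
  also have "(1 / (2 * pi)) *\<^sub>R complex_of_real (integral {-pi..pi} (\<lambda>x. (cmod (trig_poly N c x))\<^sup>2)) =
       of_real (1 / (2*pi) * integral {-pi..pi} (\<lambda>x. (cmod (trig_poly N c x))\<^sup>2))"
    by (simp add: scaleR_conv_of_real)
  finally show ?thesis unfolding of_real_eq_iff by (simp add: field_simps)
qed

lemma L2norm_trig_poly:
  "L2norm (trig_poly N c) = sqrt (2 * pi * (\<Sum>j\<in>{- int N..int N}. (cmod (c j))\<^sup>2))"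
  unfolding L2norm_def
  by (subst LINT_eq_integral) (auto intro!: continuous_intros simp: parseval_trig_poly)

lemma norm_trig_poly_le: "cmod (trig_poly N c x) \<le> (\<Sum>j\<in>{- int N..int N}. cmod (c j))"
  unfolding trig_poly_def by (rule sum_norm_le) (simp add: norm_mult)

text \<open>Inverse inequality from L2 to sup, by Cauchy-Schwarz over the \<open>2 N + 1\<close>
  frequencies. This factor is behind both the smallness threshold in the comparison of
  \<open>u\<close> with \<open>uN\<close> and the restriction on the step size.\<close>

lemma norm_trig_poly_sq_le:
  "(cmod (trig_poly N c x))\<^sup>2 \<le> (2 * real N + 1) * (\<Sum>j\<in>{- int N..int N}. (cmod (c j))\<^sup>2)"
proof -
  have "(cmod (trig_poly N c x))\<^sup>2 \<le> (\<Sum>j\<in>{- int N..int N}. 1 * cmod (c j))\<^sup>2"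
    using norm_trig_poly_le[of N c x] by (intro power_mono) auto
  also have "\<dots> \<le> (\<Sum>j\<in>{- int N..int N}. 1\<^sup>2) * (\<Sum>j\<in>{- int N..int N}. (cmod (c j))\<^sup>2)"
    by (rule Cauchy_Schwarz_ineq_sum)
  finally show ?thesis by (simp add: algebra_simps)
qed

section \<open>The semidiscrete operators acting on coefficients\<close>

lemma frac_laplacian_trig_poly:
  "frac_laplacian s (trig_poly N c) = trig_poly N (\<lambda>j. of_real (\<bar>of_int j\<bar> powr (2 * s)) * c j)"
proof
  fix x
  have "frac_laplacian s (trig_poly N c) x = (\<Sum>\<^sub>\<infinity>j\<in>{- int N..int N}.
      of_real (\<bar>of_int j\<bar> powr (2 * s)) * c j * cis (of_int j * x))"
    unfolding frac_laplacian_def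
    by (rule infsum_cong_neutral) (auto simp: fourier_coeff_trig_poly)
  thus "frac_laplacian s (trig_poly N c) x = trig_poly N (\<lambda>j. of_real (\<bar>of_int j\<bar> powr (2 * s)) * c j) x"
    by (simp add: trig_poly_def)
qed

abbreviation cub :: "complex \<Rightarrow> complex" where "cub z \<equiv> of_real ((cmod z)\<^sup>2) * z"

lemma semidiscrete_rhs_trig_poly:
  "semidiscrete_rhs s N (trig_poly N c) =
    trig_poly N (\<lambda>j. - \<i> * of_real (\<bar>of_int j\<bar> powr (2 * s)) * c j
       + \<i> * fourier_coeff (\<lambda>y. cub (trig_poly N c y)) j)"
  by (rule ext) (simp add: semidiscrete_rhs_def frac_laplacian_trig_poly fourier_proj_eq trig_poly_mult
      trig_poly_add trig_poly_diff mult.assoc del: mult_minus_left)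

section \<open>Discrete Fourier inversion\<close>

lemma sum_cis_root:
  assumes "L > 0" "\<bar>d\<bar> < int L"
  shows "(\<Sum>m<L. cis (of_int d * (2 * pi * real m / real L))) = of_bool (d = 0) * of_nat L"
proof (cases "d = 0")
  case False
  define z where "z = cis (2 * pi * of_int d / real L)"
  have pw: "z ^ m = cis (of_int d * (2 * pi * real m / real L))" for m
    unfolding z_def Complex.DeMoivre by (rule arg_cong[of _ _ cis]) (simp add: field_simps)
  have "z ^ L = 1"
    unfolding pw using assms by (simp add: complex_eq_iff mult.commute[of "of_int d"])
  \<comment> \<open>If \<open>z\<close> were 1, then \<open>d\<close> would be a multiple of
    \<open>L\<close>; since \<open>d\<close> is nonzero and smaller than \<open>L\<close> in
    absolute value, this is impossible.\<close>
  moreover have "z \<noteq> 1"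
  proof
    assume "z = 1"
    hence "cos (2 * pi * of_int d / real L) = 1" by (simp add: z_def complex_eq_iff)
    then obtain n :: int where "2 * pi * of_int d / real L = of_int n * 2 * pi"
      using cos_one_2pi_int by auto
    hence "real_of_int d = of_int n * real L" using assms by (simp add: field_simps)
    hence "d = n * int L" by (metis of_int_eq_iff of_int_mult of_int_of_nat_eq)
    moreover from this have "\<bar>d\<bar> = \<bar>n\<bar> * int L" by (simp add: abs_mult)
    moreover have "\<bar>n\<bar> * int L \<ge> 1 * int L" if "n \<noteq> 0"
      using that by (intro mult_right_mono) auto
    ultimately show False using False assms by auto
  qed
  ultimately have "(\<Sum>m<L. z ^ m) = 0" by (simp add: geometric_sum)
  thus ?thesis using False by (simp add: pw)
qed simp

text \<open>Discrete Fourier inversion: it turns pointwise differentiability in time into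
  differentiability of the coefficients.\<close>

lemma trig_poly_coeff_eq_dft:
  assumes "j \<in> {- int N..int N}"
  shows "c j = (\<Sum>m<2*N+1. trig_poly N c (2 * pi * real m / real (2*N+1)) *
     (cis (- (of_int j * (2 * pi * real m / real (2*N+1)))) / of_nat (2*N+1)))"
proof -
  define L where "L = 2 * N + 1"
  have L0: "(of_nat L :: complex) \<noteq> 0" unfolding of_nat_eq_0_iff by (simp add: L_def)
  have "(\<Sum>m<L. trig_poly N c (2 * pi * real m / real L) * (cis (- (of_int j * (2 * pi * real m / real L))) / of_nat L))
    = (\<Sum>m<L. \<Sum>l\<in>{- int N..int N}. c l / of_nat L * cis (of_int (l - j) * (2 * pi * real m / real L)))"
    unfolding trig_poly_def sum_distrib_right
    by (intro sum.cong refl) (simp add: cis_mult left_diff_distrib diff_divide_distrib)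
  also have "\<dots> = (\<Sum>l\<in>{- int N..int N}. c l / of_nat L * (\<Sum>m<L. cis (of_int (l - j) * (2 * pi * real m / real L))))"
    by (subst sum.swap) (simp add: sum_distrib_left)
  also have "\<dots> = (\<Sum>l\<in>{- int N..int N}. if l = j then c l else 0)"
    by (intro sum.cong refl, subst sum_cis_root) (use assms L0 in \<open>auto simp: L_def\<close>)
  finally show ?thesis using assms by (simp add: L_def)
qed

lemma has_vector_derivative_coeff:
  assumes "\<And>x. ((\<lambda>\<tau>. trig_poly N (c \<tau>) x) has_vector_derivative trig_poly N d x) (at t within S)"
    "j \<in> {- int N..int N}"
  shows "((\<lambda>\<tau>. c \<tau> j) has_vector_derivative d j) (at t within S)"
proof -
  have "((\<lambda>\<tau>. (\<Sum>m<2*N+1. trig_poly N (c \<tau>) (2 * pi * real m / real (2*N+1)) *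
     (cis (- (of_int j * (2 * pi * real m / real (2*N+1)))) / of_nat (2*N+1)))) has_vector_derivative
     (\<Sum>m<2*N+1. trig_poly N d (2 * pi * real m / real (2*N+1)) *
     (cis (- (of_int j * (2 * pi * real m / real (2*N+1)))) / of_nat (2*N+1)))) (at t within S)"
    by (intro has_vector_derivative_sum has_vector_derivative_mult_left assms(1))
  thus ?thesis
    unfolding trig_poly_coeff_eq_dft[OF assms(2), symmetric] .
qed

section \<open>Fourier series\<close>

lemma periodic_cis_cong:
  assumes "periodic_2pi f" "cis x = cis y"
  shows "f x = f y"
proof -
  interpret periodic_fun_simple f "2 * pi" by fact
  have "sin x = sin y \<and> cos x = cos y" using assms(2) by (simp add: complex_eq_iff)
  then obtain n :: int where "x = y + 2 * pi * n" using sin_cos_eq_iff by blast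
  thus ?thesis using plus_of_int[of y n] by (simp add: mult_ac)
qed

lemma cis_Arg2pi: "cmod z = 1 \<Longrightarrow> cis (Arg2pi z) = z"
  using complex_norm_eq_1_exp[of z] by (simp add: cis_conv_exp)

text \<open>\<open>Arg\<close> jumps across the negative real axis. There it is replaced by
  \<open>Arg2pi\<close>, which jumps across the positive axis; both are arguments of the same point,
  and \<open>f\<close> does not distinguish them.\<close>

lemma continuous_on_periodic_Arg:
  fixes f :: "real \<Rightarrow> real"
  assumes cont: "continuous_on UNIV f" and per: "\<And>x y. cis x = cis y \<Longrightarrow> f x = f y"
  shows "continuous_on (sphere 0 1) (\<lambda>z. f (Arg z))"
  unfolding continuous_on_eq_continuous_within
proof
  fix z :: complex assume z: "z \<in> sphere 0 1"
  have f: "isCont f x" for x using cont continuous_on_eq_continuous_at by blast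
  show "continuous (at z within sphere 0 1) (\<lambda>z. f (Arg z))"
  proof (cases "z \<in> \<real>\<^sub>\<le>\<^sub>0")
    case False
    have "isCont (\<lambda>z. f (Arg z)) z"
      by (rule continuous_at_compose[unfolded o_def, OF continuous_at_Arg[OF False] f])
    thus ?thesis by (rule continuous_at_imp_continuous_within)
  next
    case True
    hence "z \<notin> \<real>\<^sub>\<ge>\<^sub>0" using z by (auto simp: complex_nonpos_Reals_iff complex_nonneg_Reals_iff cmod_def)
    hence "isCont (\<lambda>z. f (Arg2pi z)) z"
      by (intro continuous_at_compose[unfolded o_def, OF continuous_at_Arg2pi f])
    hence "continuous (at z within sphere 0 1) (\<lambda>z. f (Arg2pi z))"
      by (rule continuous_at_imp_continuous_within)
    moreover have "f (Arg2pi w) = f (Arg w)" if "w \<in> sphere 0 1" for w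
      using that cis_Arg[of w] by (intro per) (cases "w = 0", auto simp: cis_Arg2pi sgn_div_norm)
    ultimately show ?thesis
      using z continuous_transform_within[of z "sphere 0 1" "\<lambda>z. f (Arg2pi z)" 1 "\<lambda>z. f (Arg z)"]
      by auto
  qed
qed

lemma continuous_on_polynomial_cis:
  "real_polynomial_function p \<Longrightarrow> continuous_on UNIV (\<lambda>x. p (cis x))"
  by (rule continuous_on_compose2[OF continuous_on_polymonial_function[of p UNIV]])
    (auto simp: real_polynomial_function_eq intro!: continuous_intros)

text \<open>The class of \<open>g\<close> such that multiplication by \<open>g\<close> preserves "all Fourier coefficients
  vanish" is closed under sums and products, which avoids expanding trigonometric polynomials.\<close>

lemma fourier_coeff_mult_polynomial_zero:
  fixes p :: "complex \<Rightarrow> real"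
  assumes "real_polynomial_function p" "continuous_on UNIV f" "\<And>j. fourier_coeff f j = 0"
  shows "fourier_coeff (\<lambda>x. f x * of_real (p (cis x))) j = 0"
  using assms
proof (induction p arbitrary: f j rule: real_polynomial_function.induct)
  case (linear p)
  have shift: "fourier_coeff (\<lambda>x. f x * cis (of_int l * x)) j = 0" for l
  proof -
    have "fourier_coeff (\<lambda>x. f x * cis (of_int l * x)) j = fourier_coeff f (j - l)"
      unfolding fourier_coeff_def by (simp add: cis_mult mult.assoc algebra_simps)
    thus ?thesis using linear by simp
  qed
  interpret p: bounded_linear p by fact
  have p: "p (cis x) = cos x * p 1 + sin x * p \<i>" for x
  proof -
    have "cis x = cos x *\<^sub>R 1 + sin x *\<^sub>R \<i>" by (simp add: complex_eq_iff)
    thus ?thesis by (simp only: p.add p.scaleR) simp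
  qed
  \<comment> \<open>A real linear \<open>p\<close> on the circle is a combination of cosine and
    sine, that is, \<open>p (cis x) = A * cis x + B * cis (- x)\<close>. Multiplication by it only
    shifts frequencies by one.\<close>
  define A where "A = (complex_of_real (p 1) - \<i> * of_real (p \<i>)) / 2"
  define B where "B = (complex_of_real (p 1) + \<i> * of_real (p \<i>)) / 2"
  have "fourier_coeff (\<lambda>x. f x * of_real (p (cis x))) j =
      fourier_coeff (\<lambda>x. A * (f x * cis (of_int 1 * x)) + B * (f x * cis (of_int (-1) * x))) j"
    by (rule arg_cong[of _ _ "\<lambda>h. fourier_coeff h j"])
      (auto simp: p A_def B_def complex_eq_iff fun_eq_iff field_simps)
  also have "\<dots> = 0"
    by (subst fourier_coeff_add, (intro continuous_intros linear)+, subst (1 2) fourier_coeff_mult_left)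
      (intro continuous_intros linear | simp add: shift del: of_int_1 of_int_minus)+
  finally show ?case .
next
  case (const c)
  then show ?case by (simp add: mult.commute[of _ "complex_of_real c"] fourier_coeff_mult_left)
next
  case (add p q)
  have "continuous_on UNIV (\<lambda>x. p (cis x))" "continuous_on UNIV (\<lambda>x. q (cis x))"
    using add.hyps by (auto intro!: continuous_on_polynomial_cis)
  thus ?case using add by (simp add: distrib_left fourier_coeff_add continuous_on_mult continuous_on_of_real)
next
  case (mult p q)
  have "continuous_on UNIV (\<lambda>x. p (cis x))"
    using mult.hyps by (auto intro!: continuous_on_polynomial_cis)
  thus ?case using mult.IH(2)[of "\<lambda>x. f x * of_real (p (cis x))"] mult.IH(1)[of f] mult.prems
    by (simp add: mult.assoc continuous_on_mult continuous_on_of_real)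
qed

text \<open>Stone-Weierstrass approximates \<open>g\<close>, viewed on the unit circle, uniformly by
  polynomials in \<open>cis x\<close>, and \<open>f\<close> integrates to zero against each of
  these.\<close>

lemma integral_mult_periodic_zero:
  fixes g :: "real \<Rightarrow> real"
  assumes f: "continuous_on UNIV f" "\<And>j. fourier_coeff f j = 0"
    and g: "continuous_on UNIV g" "\<And>x y. cis x = cis y \<Longrightarrow> g x = g y"
  shows "integral {-pi..pi} (\<lambda>x. f x * of_real (g x)) = 0"
proof (rule ccontr)
  define I where "I = integral {-pi..pi} (\<lambda>x. f x * of_real (g x))"
  define F where "F = integral {-pi..pi} (\<lambda>x. cmod (f x))"
  assume "\<not> ?thesis"
  hence I: "cmod I > 0" by (simp add: I_def)
  have F: "F \<ge> 0" unfolding F_def by (intro integral_nonneg integrable_on_continuous_UNIV continuous_intros f) auto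
  \<comment> \<open>With this accuracy the approximation error \<open>e * F\<close> stays strictly
    below \<open>cmod I\<close>; the \<open>+ 1\<close> covers the case
    \<open>F = 0\<close>.\<close>
  define e where "e = cmod I / (F + 1)"
  have e: "e > 0" using I F by (simp add: e_def)
  obtain p where p: "real_polynomial_function p" "\<And>z. z \<in> sphere 0 1 \<Longrightarrow> \<bar>g (Arg z) - p z\<bar> < e"
    using Stone_Weierstrass_real_polynomial_function[OF compact_sphere continuous_on_periodic_Arg[OF g] e]
    by metis
  have close: "\<bar>g x - p (cis x)\<bar> < e" for x
    using p(2)[of "cis x"] g(2)[of "Arg (cis x)" x] by (simp add: cis_Arg sgn_div_norm)
  have cp: "continuous_on UNIV (\<lambda>x. p (cis x))"
    using p(1) by (auto intro!: continuous_on_polynomial_cis)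
  have "integral {-pi..pi} (\<lambda>x. f x * of_real (p (cis x))) = 0"
    using fourier_coeff_mult_polynomial_zero[OF p(1) f, of 0]
    by (subst (asm) fourier_coeff_integral) (auto intro!: continuous_intros continuous_on_subset[OF f(1)] continuous_on_subset[OF cp])
  hence "I = integral {-pi..pi} (\<lambda>x. f x * of_real (g x)) - integral {-pi..pi} (\<lambda>x. f x * of_real (p (cis x)))"
    by (simp add: I_def)
  also have "\<dots> = integral {-pi..pi} (\<lambda>x. f x * of_real (g x - p (cis x)))"
    by (subst integral_diff[symmetric]) (auto intro!: continuous_intros f g cp simp: right_diff_distrib)
  also have "cmod \<dots> \<le> integral {-pi..pi} (\<lambda>x. e * cmod (f x))"
    by (rule integral_norm_bound_integral)
      (auto intro!: continuous_intros f g cp mult_left_mono less_imp_le[OF close] simp: norm_mult mult.commute[of e] simp del: of_real_diff)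
  also have "\<dots> = e * F" by (simp add: F_def)
  also have "\<dots> < cmod I" using I F by (simp add: e_def field_simps)
  finally show False by simp
qed

text \<open>\<open>f\<close> is tested against its own real and imaginary parts, which are
  continuous and periodic; together they give the integral of the square of
  \<open>cmod (f x)\<close>.\<close>

lemma fourier_coeff_zero_imp_zero:
  assumes f: "continuous_on UNIV f" "\<And>j. fourier_coeff f j = 0" and per: "periodic_2pi f"
  shows "f x = 0"
proof -
  have i: "(\<lambda>x. (cmod (f x))\<^sup>2) integrable_on {-pi..pi}"
    by (intro integrable_on_continuous_UNIV continuous_intros f)
  have "complex_of_real (integral {-pi..pi} (\<lambda>x. (cmod (f x))\<^sup>2)) = integral {-pi..pi} (\<lambda>x. of_real ((cmod (f x))\<^sup>2))"
    using integral_linear[OF i bounded_linear_of_real[where 'a=complex]] by (simp add: o_def)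
  also have "\<dots> = integral {-pi..pi} (\<lambda>x. f x * of_real (Re (f x)) - \<i> * (f x * of_real (Im (f x))))"
    by (rule integral_cong) (simp add: complex_eq_iff cmod_power2, simp add: power2_eq_square)
  also have "\<dots> = integral {-pi..pi} (\<lambda>x. f x * of_real (Re (f x))) - \<i> * integral {-pi..pi} (\<lambda>x. f x * of_real (Im (f x)))"
    by (subst integral_diff) (auto intro!: continuous_intros f)
  also have "\<dots> = 0"
    by (subst (1 2) integral_mult_periodic_zero)
      (auto intro!: continuous_intros f arg_cong[OF periodic_cis_cong[OF per]])
  finally have "\<forall>x\<in>{-pi..pi}. (cmod (f x))\<^sup>2 = 0"
    by (subst integral_eq_0_iff[symmetric]) (auto intro!: continuous_intros continuous_on_subset[OF f(1)])
  \<comment> \<open>Periodicity carries the vanishing from \<open>{-pi..pi}\<close> to an arbitrary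
    \<open>x\<close>.\<close>
  moreover have "Arg (cis x) \<in> {-pi..pi}" using Arg_bounded[of "cis x"] by auto
  ultimately have "f (Arg (cis x)) = 0" by auto
  thus ?thesis using periodic_cis_cong[OF per, of "Arg (cis x)" x] by (simp add: cis_Arg sgn_div_norm)
qed

section \<open>Absolutely convergent Fourier series and inversion\<close>

definition fourier_series :: "(int \<Rightarrow> complex) \<Rightarrow> real \<Rightarrow> complex" where
  "fourier_series a x = (\<Sum>\<^sub>\<infinity>j. a j * cis (of_int j * x))"

lemma uniform_limit_fourier_series:
  assumes "(\<lambda>j. cmod (a j)) summable_on UNIV"
  shows "uniform_limit UNIV (\<lambda>X x. \<Sum>j\<in>X. a j * cis (of_int j * x)) (fourier_series a) (finite_subsets_at_top UNIV)"
  unfolding fourier_series_def[abs_def]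
  by (rule Weierstrass_m_test_general[OF _ assms]) (simp add: norm_mult)

lemma continuous_fourier_series:
  assumes "(\<lambda>j. cmod (a j)) summable_on UNIV"
  shows "continuous_on UNIV (fourier_series a)"
  by (rule uniform_limit_theorem[OF _ uniform_limit_fourier_series[OF assms]])
    (auto intro!: always_eventually continuous_intros)

lemma norm_fourier_series_le:
  assumes "(\<lambda>j. cmod (a j)) summable_on UNIV"
  shows "cmod (fourier_series a x) \<le> (\<Sum>\<^sub>\<infinity>j. cmod (a j))"
proof -
  have "(\<lambda>j. cmod (a j * cis (of_int j * x))) summable_on UNIV" using assms by (simp add: norm_mult)
  from norm_infsum_bound[OF this] show ?thesis by (simp add: fourier_series_def norm_mult)
qed

text \<open>Uniform convergence of the finite partial sums allows integration term by term.\<close>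

lemma fourier_coeff_fourier_series:
  assumes "(\<lambda>j. cmod (a j)) summable_on UNIV"
  shows "fourier_coeff (fourier_series a) j = a j"
proof -
  define e where "e = (\<lambda>x. cis (- (of_int j * x)))"
  have "uniform_limit {-pi..pi} (\<lambda>X x. \<Sum>l\<in>X. a l * cis (of_int l * x) * e x)
      (\<lambda>x. \<Sum>\<^sub>\<infinity>l. a l * cis (of_int l * x) * e x) (finite_subsets_at_top UNIV)"
    by (rule Weierstrass_m_test_general[OF _ assms]) (simp add: norm_mult e_def)
  hence "uniform_limit {-pi..pi} (\<lambda>X x. (\<Sum>l\<in>X. a l * cis (of_int l * x)) * e x)
      (\<lambda>x. fourier_series a x * e x) (finite_subsets_at_top UNIV)"
    by (simp add: sum_distrib_right infsum_cmult_left' fourier_series_def)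
  then obtain I J where
    I: "\<And>X. ((\<lambda>x. (\<Sum>l\<in>X. a l * cis (of_int l * x)) * e x) has_integral I X) {-pi..pi}" and
    J: "((\<lambda>x. fourier_series a x * e x) has_integral J) {-pi..pi}" and
    lim: "(I \<longlongrightarrow> J) (finite_subsets_at_top UNIV)"
    by (rule uniform_limit_integral) (auto simp: e_def intro!: continuous_intros)
  have c: "continuous_on UNIV (\<lambda>x. \<Sum>l\<in>X. a l * cis (of_int l * x))" for X
    by (intro continuous_intros)
  \<comment> \<open>Once \<open>X\<close> contains \<open>j\<close>, orthogonality fixes the
    integral, so it is eventually constant along the filter of finite sets.\<close>
  have "I X = 2 * pi * a j" if "finite X" "j \<in> X" for X
  proof -
    have "fourier_coeff (\<lambda>x. \<Sum>l\<in>X. a l * cis (of_int l * x)) j =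
        (\<Sum>l\<in>X. fourier_coeff (\<lambda>x. a l * cis (of_int l * x)) j)"
      using that by (intro fourier_coeff_sum continuous_intros)
    also have "\<dots> = (\<Sum>l\<in>X. if l = j then a l else 0)"
      by (rule sum.cong) (auto simp: fourier_coeff_mult_left fourier_coeff_cis continuous_intros)
    also have "\<dots> = a j" using that by simp
    finally have "(1 / (2 * pi)) *\<^sub>R I X = a j"
      using integral_unique[OF I[of X]] fourier_coeff_integral[OF continuous_on_subset[OF c], of X j]
      by (simp add: e_def)
    thus ?thesis by (auto simp: scaleR_conv_of_real field_simps)
  qed
  hence "eventually (\<lambda>X. I X = 2 * pi * a j) (finite_subsets_at_top UNIV)"
    unfolding eventually_finite_subsets_at_top by (intro exI[of _ "{j}"]) auto
  hence "(I \<longlongrightarrow> 2 * pi * a j) (finite_subsets_at_top UNIV)" by (rule tendsto_eventually)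
  hence "J = 2 * pi * a j" using lim tendsto_unique finite_subsets_at_top_neq_bot by blast
  thus ?thesis using integral_unique[OF J[unfolded e_def]]
    by (simp add: fourier_coeff_integral continuous_on_subset[OF continuous_fourier_series[OF assms]]
        scaleR_conv_of_real)
qed

lemma periodic_fourier_series: "fourier_series a (x + 2 * pi) = fourier_series a x"
proof -
  have "cis (of_int j * (x + 2 * pi)) = cis (of_int j * x)" for j
    using cis_multiple_2pi[of "of_int j"] by (simp add: distrib_left cis_mult[symmetric] mult_ac)
  thus ?thesis by (simp add: fourier_series_def)
qed

text \<open>The difference of \<open>f\<close> and its series is continuous and periodic with
  vanishing coefficients, so the uniqueness result applies to it.\<close>

theorem fourier_inversion:
  assumes "continuous_on UNIV f" "periodic_2pi f" "(\<lambda>j. cmod (fourier_coeff f j)) summable_on UNIV"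
  shows "f = fourier_series (fourier_coeff f)"
proof
  fix x
  interpret periodic_fun_simple f "2 * pi" by fact
  let ?g = "\<lambda>x. f x + (-1) * fourier_series (fourier_coeff f) x"
  have c: "continuous_on UNIV (fourier_series (fourier_coeff f))"
    by (rule continuous_fourier_series[OF assms(3)])
  have "?g x = 0"
  proof (rule fourier_coeff_zero_imp_zero)
    show "continuous_on UNIV ?g" by (intro continuous_intros assms c)
    show "fourier_coeff ?g j = 0" for j
      by (subst fourier_coeff_add, intro assms, intro continuous_intros c, subst fourier_coeff_mult_left)
        (simp_all add: c fourier_coeff_fourier_series[OF assms(3)])
    show "periodic_2pi ?g" by unfold_locales (simp add: periodic_fourier_series plus_1)
  qed
  thus "f x = fourier_series (fourier_coeff f) x" by simp
qed

section \<open>Time derivatives of Fourier coefficients\<close>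

lemma fourier_coeff_tendsto_zero:
  assumes "\<And>n. continuous_on UNIV (\<phi> n)" "\<And>n x. cmod (\<phi> n x) \<le> D" "\<And>x. (\<lambda>n::nat. \<phi> n x) \<longlonglongrightarrow> 0"
  shows "(\<lambda>n. fourier_coeff (\<phi> n) j) \<longlonglongrightarrow> 0"
proof -
  have "(\<lambda>n. integral {-pi..pi} (\<lambda>x. \<phi> n x * cis (- (of_int j * x)))) \<longlonglongrightarrow> integral {-pi..pi} (\<lambda>x. 0)"
  proof (rule dominated_convergence(2))
    show "(\<lambda>x. \<phi> n x * cis (- (of_int j * x))) integrable_on {-pi..pi}" for n
      by (intro integrable_on_continuous_UNIV continuous_intros assms)
    show "(\<lambda>x::real. D) integrable_on {-pi..pi}" by (intro integrable_on_continuous_UNIV continuous_intros)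
    show "norm (\<phi> n x * cis (- (of_int j * x))) \<le> D" for n x using assms(2) by (simp add: norm_mult)
    show "(\<lambda>n. \<phi> n x * cis (- (of_int j * x))) \<longlonglongrightarrow> 0" for x
      by (rule tendsto_mult_left_zero[OF assms(3)])
  qed
  hence "(\<lambda>n. (1 / (2 * pi)) *\<^sub>R integral {-pi..pi} (\<lambda>x. \<phi> n x * cis (- (of_int j * x)))) \<longlonglongrightarrow> (1 / (2 * pi)) *\<^sub>R 0"
    by (intro tendsto_scaleR tendsto_const) simp
  thus ?thesis using assms(1) by (subst fourier_coeff_integral) (auto intro: continuous_on_subset)
qed

lemma norm_diff_le_vector_derivative:
  fixes f :: "real \<Rightarrow> complex"
  assumes "\<And>t. t \<in> {a..b} \<Longrightarrow> (f has_vector_derivative f' t) (at t within {a..b})"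
    "\<And>t. t \<in> {a..b} \<Longrightarrow> cmod (f' t) \<le> D" "x \<in> {a..b}" "y \<in> {a..b}"
  shows "cmod (f x - f y) \<le> D * \<bar>x - y\<bar>"
proof -
  have "norm (f x - f y) \<le> D * norm (x - y)"
  proof (rule differentiable_bound[of "{a..b}" f "\<lambda>t h. h *\<^sub>R f' t"])
    show "(f has_derivative (\<lambda>h. h *\<^sub>R f' t)) (at t within {a..b})" if "t \<in> {a..b}" for t
      using assms(1)[OF that] by (simp add: has_vector_derivative_def)
    show "onorm (\<lambda>h. h *\<^sub>R f' t) \<le> D" if "t \<in> {a..b}" for t
      using assms(2)[OF that] by (intro onorm_le) (simp add: mult.commute[of D] mult_left_mono)
  qed (use assms in auto)
  thus ?thesis by simp
qed

text \<open>Differentiation under the integral without joint continuity in time and space: the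
  difference quotients are uniformly bounded by the mean value inequality, and dominated convergence
  is applied along sequences of times.\<close>

lemma has_vector_derivative_fourier_coeff:
  assumes cu: "\<And>t. t \<in> {0..T} \<Longrightarrow> continuous_on UNIV (u t)"
    and cd: "\<And>t. t \<in> {0..T} \<Longrightarrow> continuous_on UNIV (d t)"
    and der: "\<And>t x. t \<in> {0..T} \<Longrightarrow> ((\<lambda>\<tau>. u \<tau> x) has_vector_derivative d t x) (at t within {0..T})"
    and bd: "\<And>t x. t \<in> {0..T} \<Longrightarrow> cmod (d t x) \<le> D"
    and t: "t \<in> {0..T}"
  shows "((\<lambda>\<tau>. fourier_coeff (u \<tau>) j) has_vector_derivative fourier_coeff (d t) j) (at t within {0..T})"
  unfolding has_vector_derivative_def has_derivative_within
proof (intro conjI bounded_linear_scaleR_left, unfold tendsto_at_iff_sequentially, intro allI impI)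
  fix X :: "nat \<Rightarrow> real" assume X: "\<forall>i. X i \<in> {0..T} - {t}" "X \<longlonglongrightarrow> t"
  \<comment> \<open>The normalised remainder in the definition of the derivative. Its bound
    \<open>2 * D\<close> takes one \<open>D\<close> from the mean value inequality and one from
    \<open>d t\<close>.\<close>
  define \<phi> where "\<phi> = (\<lambda>y x. (1 / norm (y - t)) *\<^sub>R (u y x - (u t x + (y - t) *\<^sub>R d t x)))"
  have eq: "(1 / norm (y - t)) *\<^sub>R (fourier_coeff (u y) j - (fourier_coeff (u t) j + (y - t) *\<^sub>R fourier_coeff (d t) j))
     = fourier_coeff (\<phi> y) j" if "y \<in> {0..T}" for y
  proof -
    have "fourier_coeff (\<phi> y) j = fourier_coeff (\<lambda>x. of_real (1 / norm (y - t)) * (u y x + ((-1) * u t x + of_real (-(y - t)) * d t x))) j"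
      by (rule arg_cong[of _ _ "\<lambda>h. fourier_coeff h j"]) (simp add: \<phi>_def scaleR_conv_of_real algebra_simps)
    also have "\<dots> = of_real (1 / norm (y - t)) * (fourier_coeff (u y) j + ((-1) * fourier_coeff (u t) j + of_real (-(y - t)) * fourier_coeff (d t) j))"
      using cu[OF that] cu[OF t] cd[OF t]
      by (simp only: fourier_coeff_mult_left fourier_coeff_add continuous_on_add continuous_on_mult continuous_on_const)
    finally show ?thesis by (simp add: scaleR_conv_of_real algebra_simps)
  qed
  have "(\<lambda>n. fourier_coeff (\<phi> (X n)) j) \<longlonglongrightarrow> 0"
  proof (rule fourier_coeff_tendsto_zero[where D = "2 * D"])
    fix n x
    have Xn: "X n \<in> {0..T}" "X n \<noteq> t" using X by auto
    show "continuous_on UNIV (\<phi> (X n))" unfolding \<phi>_def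
      using cu[OF Xn(1)] cu[OF t] cd[OF t] by (intro continuous_intros)
    have "cmod (u (X n) x - (u t x + (X n - t) *\<^sub>R d t x)) \<le> cmod (u (X n) x - u t x) + cmod ((X n - t) *\<^sub>R d t x)"
      by (metis diff_diff_eq norm_triangle_ineq4)
    also have "\<dots> \<le> D * \<bar>X n - t\<bar> + \<bar>X n - t\<bar> * D"
      using norm_diff_le_vector_derivative[of 0 T "\<lambda>\<tau>. u \<tau> x" "\<lambda>t. d t x" D "X n" t, OF der bd Xn(1) t] bd[OF t, of x]
      by (intro add_mono) (auto intro: mult_left_mono)
    finally show "cmod (\<phi> (X n) x) \<le> 2 * D" using Xn
      unfolding \<phi>_def norm_scaleR by (simp add: divide_le_eq mult_ac)
  next
    fix x
    from der[OF t, of x] have "((\<lambda>y. \<phi> y x) \<longlongrightarrow> 0) (at t within {0..T})"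
      unfolding has_vector_derivative_def has_derivative_within \<phi>_def by blast
    with X show "(\<lambda>n. \<phi> (X n) x) \<longlonglongrightarrow> 0"
      unfolding tendsto_at_iff_sequentially o_def by blast
  qed
  thus "((\<lambda>y. (1 / norm (y - t)) *\<^sub>R (fourier_coeff (u y) j - (fourier_coeff (u t) j + (y - t) *\<^sub>R fourier_coeff (d t) j))) \<circ> X) \<longlonglongrightarrow> 0"
    unfolding o_def by (subst eq) (use X(1) in auto)
qed

section \<open>Weighted bounds and the cubic convolution\<close>

definition weight :: "nat \<Rightarrow> int \<Rightarrow> real" where
  "weight p j = 1 / (1 + \<bar>of_int j\<bar>) ^ p"

lemma weight_pos: "weight p j > 0" by (simp add: weight_def add_pos_nonneg)
lemma weight_nonneg [simp]: "weight p j \<ge> 0" using weight_pos[of p j] by simp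
lemma weight_minus [simp]: "weight p (- j) = weight p j" by (simp add: weight_def)

lemma weight_antimono: "p \<le> q \<Longrightarrow> weight q j \<le> weight p j"
  unfolding weight_def by (intro divide_left_mono power_increasing) (auto intro!: mult_pos_pos add_pos_nonneg)

lemma weight_add: "weight (p + q) j = weight p j * weight q j"
  by (simp add: weight_def power_add)

text \<open>Telescoping: \<open>2 / (n + 2)^2\<close> is at most
  \<open>2 / (n + 1) - 2 / (n + 2)\<close>. The subtracted term in the bound is what carries the
  induction.\<close>

lemma sum_weight_two_symmetric: "(\<Sum>j\<in>{- int n..int n}. weight 2 j) \<le> 3 - 2 / (real n + 1)"
proof (induction n)
  case (Suc n)
  have eq: "{- int (Suc n)..int (Suc n)} = insert (int n + 1) (insert (- (int n + 1)) {- int n..int n})" by auto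
  have "(\<Sum>j\<in>{- int (Suc n)..int (Suc n)}. weight 2 j) = 2 * weight 2 (int n + 1) + (\<Sum>j\<in>{- int n..int n}. weight 2 j)"
    unfolding eq using weight_minus[of 2 "int n + 1"] by (subst sum.insert, simp, simp)+ simp
  also have "\<dots> \<le> 2 / (real n + 2)\<^sup>2 + (3 - 2 / (real n + 1))"
    by (intro add_mono Suc) (simp add: weight_def add.commute)
  also have "\<dots> \<le> 3 - 2 / (real (Suc n) + 1)"
  proof -
    have "2 / (real n + 2)\<^sup>2 \<le> 2 / ((real n + 1) * (real n + 2))"
      by (intro frac_le mult_pos_pos) (auto simp: power2_eq_square intro!: mult_right_mono)
    also have "\<dots> = 2 / (real n + 1) - 2 / (real (Suc n) + 1)" by (simp add: field_simps)
    finally show ?thesis by simp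
  qed
  finally show ?case .
qed (simp add: weight_def)

lemma sum_weight_le:
  assumes "finite F" "p \<ge> 2"
  shows "(\<Sum>j\<in>F. weight p j) \<le> 3"
proof -
  \<comment> \<open>Any common bound for the frequencies in \<open>F\<close> serves; the sum of
    their absolute values is one.\<close>
  define n where "n = nat (\<Sum>j\<in>F. \<bar>j\<bar>)"
  have "F \<subseteq> {- int n..int n}"
  proof
    fix j assume "j \<in> F"
    hence "\<bar>j\<bar> \<le> (\<Sum>j\<in>F. \<bar>j\<bar>)" by (intro member_le_sum assms) auto
    thus "j \<in> {- int n..int n}" by (auto simp: n_def)
  qed
  have "(\<Sum>j\<in>F. weight p j) \<le> (\<Sum>j\<in>F. weight 2 j)" by (intro sum_mono weight_antimono assms)
  also have "\<dots> \<le> (\<Sum>j\<in>{- int n..int n}. weight 2 j)"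
    by (rule sum_mono2) (use \<open>F \<subseteq> _\<close> in auto)
  also have "\<dots> \<le> 3 - 2 / (real n + 1)" by (rule sum_weight_two_symmetric)
  also have "\<dots> \<le> 3" by simp
  finally show ?thesis .
qed

lemma weight_summable_on: "p \<ge> 2 \<Longrightarrow> weight p summable_on A"
  by (rule nonneg_bdd_above_summable_on) (auto intro!: bdd_aboveI[where M = 3] sum_weight_le)

lemma infsum_weight_le: "p \<ge> 2 \<Longrightarrow> infsum (weight p) A \<le> 3"
  by (rule infsum_le_finite_sums) (auto intro!: sum_weight_le weight_summable_on)

text \<open>\<open>1 + |j|\<close> is at most twice the larger of \<open>1 + |l|\<close> and
  \<open>1 + |j - l|\<close>. One factor on the left thus already decays like
  \<open>weight p j\<close>, and the other remains available for summation over
  \<open>l\<close>.\<close>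

lemma weight_mult_le:
  "weight p l * weight p (j - l) \<le> 2 ^ p * weight p j * (weight p l + weight p (j - l))"
proof -
  define a b c where abc: "a = 1 + \<bar>real_of_int l\<bar>" "b = 1 + \<bar>real_of_int (j - l)\<bar>" "c = 1 + \<bar>real_of_int j\<bar>"
  have pos: "a > 0" "b > 0" "c > 0" by (auto simp: abc add_pos_nonneg)
  have "c \<le> a + b" unfolding abc by simp
  hence "c \<le> 2 * max a b" by linarith
  hence "c ^ p \<le> (2 * max a b) ^ p" using pos by (intro power_mono) auto
  also have "\<dots> = 2 ^ p * max a b ^ p" by (simp add: power_mult_distrib)
  also have "\<dots> \<le> 2 ^ p * (a ^ p + b ^ p)" using pos by (intro mult_left_mono) (auto simp: max_def)
  finally have "1 \<le> 2 ^ p * (a ^ p + b ^ p) / c ^ p" using pos by (simp add: le_divide_eq)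
  hence "1 / (a ^ p * b ^ p) \<le> (2 ^ p * (a ^ p + b ^ p) / c ^ p) / (a ^ p * b ^ p)"
    using pos by (intro divide_right_mono) auto
  also have "\<dots> = 2 ^ p * (1 / c ^ p) * (1 / a ^ p + 1 / b ^ p)"
    using pos by (simp add: field_simps)
  finally show ?thesis by (simp add: weight_def abc)
qed

lemma weight_convolution:
  assumes "finite F" "p \<ge> 2"
  shows "(\<Sum>l\<in>F. weight p l * weight p (j - l)) \<le> 6 * 2 ^ p * weight p j"
proof -
  have "(\<Sum>l\<in>F. weight p (j - l)) = (\<Sum>l\<in>(\<lambda>l. j - l) ` F. weight p l)"
    by (subst sum.reindex) (auto simp: inj_on_def)
  also have "\<dots> \<le> 3" using assms by (intro sum_weight_le) auto
  finally have *: "(\<Sum>l\<in>F. weight p (j - l)) \<le> 3" .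
  have "(\<Sum>l\<in>F. weight p l * weight p (j - l)) \<le> (\<Sum>l\<in>F. 2 ^ p * weight p j * (weight p l + weight p (j - l)))"
    by (intro sum_mono weight_mult_le)
  also have "\<dots> = 2 ^ p * weight p j * ((\<Sum>l\<in>F. weight p l) + (\<Sum>l\<in>F. weight p (j - l)))"
    unfolding sum.distrib[symmetric] by (rule sum_distrib_left[symmetric])
  also have "\<dots> \<le> 2 ^ p * weight p j * (3 + 3)"
    by (intro mult_left_mono add_mono sum_weight_le assms *) auto
  finally show ?thesis by simp
qed

text \<open>The coefficients of \<open>f g (cnj h)\<close> for trigonometric polynomials \<open>f\<close>, \<open>g\<close>, \<open>h\<close>.\<close>

definition tri :: "nat \<Rightarrow> (int \<Rightarrow> complex) \<Rightarrow> (int \<Rightarrow> complex) \<Rightarrow> (int \<Rightarrow> complex) \<Rightarrow> int \<Rightarrow> complex" where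
  "tri N a b c j = (\<Sum>l\<in>{- int N..int N}. \<Sum>m\<in>{- int N..int N}. \<Sum>n\<in>{- int N..int N}.
     of_bool (l + m - n = j) * (a l * b m * cnj (c n)))"

lemma fourier_coeff_cub: "fourier_coeff (\<lambda>y. cub (trig_poly N c y)) j = tri N c c c j"
proof -
  let ?I = "{- int N..int N}"
  have "cub (trig_poly N c y) = (\<Sum>l\<in>?I. \<Sum>m\<in>?I. \<Sum>n\<in>?I. (c l * c m * cnj (c n)) * cis (of_int (l + m - n) * y))" for y
  proof -
    have "cub (trig_poly N c y) = trig_poly N c y * trig_poly N c y * cnj (trig_poly N c y)"
      by (simp only: complex_norm_square) simp
    also have "\<dots> = (\<Sum>l\<in>?I. \<Sum>m\<in>?I. \<Sum>n\<in>?I. (c l * cis (of_int l * y)) * (c m * cis (of_int m * y)) * (cnj (c n) * cis (- (of_int n * y))))"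
      unfolding trig_poly_def cnj_sum complex_cnj_mult cis_cnj
      by (simp only: sum_distrib_left[symmetric] sum_distrib_right[symmetric])
    also have "\<dots> = (\<Sum>l\<in>?I. \<Sum>m\<in>?I. \<Sum>n\<in>?I. (c l * c m * cnj (c n)) * (cis (of_int l * y) * cis (of_int m * y) * cis (- (of_int n * y))))"
      by (simp add: mult_ac)
    finally show ?thesis by (simp add: cis_mult algebra_simps)
  qed
  hence "fourier_coeff (\<lambda>y. cub (trig_poly N c y)) j =
    fourier_coeff (\<lambda>y. \<Sum>l\<in>?I. \<Sum>m\<in>?I. \<Sum>n\<in>?I. (c l * c m * cnj (c n)) * cis (of_int (l + m - n) * y)) j"
    by presburger
  also have "\<dots> = (\<Sum>l\<in>?I. \<Sum>m\<in>?I. \<Sum>n\<in>?I. (c l * c m * cnj (c n)) * of_bool (l + m - n = j))"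
    by (subst fourier_coeff_sum, simp, intro continuous_intros)+
      (simp add: fourier_coeff_mult_left continuous_intros fourier_coeff_cis del: of_int_add of_int_diff)
  finally show ?thesis by (simp add: tri_def mult.commute)
qed

text \<open>A weighted sup norm, restricted to the frequencies up to \<open>N\<close> because
  \<open>tri\<close> also takes nonzero values beyond them, which \<open>trig_poly N\<close>
  ignores.\<close>

definition weight_bounded :: "nat \<Rightarrow> nat \<Rightarrow> real \<Rightarrow> (int \<Rightarrow> complex) \<Rightarrow> bool" where
  "weight_bounded N p K a \<longleftrightarrow> (\<forall>j\<in>{- int N..int N}. cmod (a j) \<le> K * weight p j)"

lemma weight_bounded_mono:
  assumes "weight_bounded N q K a" "p \<le> q" "K \<ge> 0"
  shows "weight_bounded N p K a"
  unfolding weight_bounded_def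
  using assms(1) mult_left_mono[OF weight_antimono[OF assms(2)] assms(3)]
  by (auto simp: weight_bounded_def intro: order_trans)

lemma weight_bounded_add:
  assumes "weight_bounded N p K a" "weight_bounded N p L b"
  shows "weight_bounded N p (K + L) (\<lambda>j. a j + b j)"
  using assms unfolding weight_bounded_def
  by (auto simp: distrib_right intro!: norm_triangle_mono)

lemma weight_bounded_i_mult:
  "weight_bounded N p K a \<Longrightarrow> weight_bounded N p K (\<lambda>j. \<i> * a j)"
  by (auto simp: weight_bounded_def norm_mult)

lemma sum_weight_bounded_le:
  assumes "weight_bounded N p K a" "p \<ge> 2" "K \<ge> 0"
  shows "(\<Sum>j\<in>{- int N..int N}. cmod (a j)) \<le> 3 * K"
proof -
  have "(\<Sum>j\<in>{- int N..int N}. cmod (a j)) \<le> (\<Sum>j\<in>{- int N..int N}. K * weight p j)"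
    using assms(1) by (intro sum_mono) (auto simp: weight_bounded_def)
  also have "\<dots> = K * (\<Sum>j\<in>{- int N..int N}. weight p j)" by (simp add: sum_distrib_left)
  also have "\<dots> \<le> K * 3" by (intro mult_left_mono sum_weight_le assms) auto
  finally show ?thesis by simp
qed

lemma sum_weight_bounded_sq_le:
  assumes "weight_bounded N p K a" "p \<ge> 2"
  shows "(\<Sum>j\<in>{- int N..int N}. (cmod (a j))\<^sup>2) \<le> 3 * K\<^sup>2"
proof -
  have "(\<Sum>j\<in>{- int N..int N}. (cmod (a j))\<^sup>2) \<le> (\<Sum>j\<in>{- int N..int N}. K\<^sup>2 * weight p j)"
  proof (intro sum_mono)
    fix j assume "j \<in> {- int N..int N}"
    hence "(cmod (a j))\<^sup>2 \<le> (K * weight p j)\<^sup>2"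
      using assms(1) by (intro power_mono) (auto simp: weight_bounded_def)
    also have "\<dots> = K\<^sup>2 * (weight p j * weight p j)" by (simp add: power_mult_distrib power2_eq_square)
    \<comment> \<open>\<open>weight 0 j\<close> is 1, so a product of two weights is at most a
      single one.\<close>
    also have "\<dots> \<le> K\<^sup>2 * (weight p j * weight 0 j)"
      by (intro mult_left_mono weight_antimono) auto
    finally show "(cmod (a j))\<^sup>2 \<le> K\<^sup>2 * weight p j" by (simp add: weight_def)
  qed
  also have "\<dots> = K\<^sup>2 * (\<Sum>j\<in>{- int N..int N}. weight p j)" by (simp add: sum_distrib_left)
  also have "\<dots> \<le> K\<^sup>2 * 3" by (intro mult_left_mono sum_weight_le assms) auto
  finally show ?thesis by simp
qed

text \<open>The constraint \<open>l + m - n = j\<close> eliminates \<open>n\<close>; the remaining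
  double sum is a convolution of three weights, and \<open>weight_convolution\<close> is applied
  twice. This explains the square in the constant, which is independent of \<open>N\<close>.\<close>

lemma weight_bounded_tri:
  assumes p: "p \<ge> 2" and nn: "A \<ge> 0" "B \<ge> 0" "C \<ge> 0"
    and a: "weight_bounded N p A a" and b: "weight_bounded N p B b" and c: "weight_bounded N p C c"
  shows "weight_bounded N p ((6 * 2 ^ p)\<^sup>2 * (A * B * C)) (tri N a b c)"
  unfolding weight_bounded_def
proof
  fix j
  let ?I = "{- int N..int N}" and ?E = "6 * 2 ^ p :: real"
  \<comment> \<open>For given \<open>l\<close> and \<open>m\<close> only
    \<open>n = l + m - j\<close> can contribute. Only an inequality holds, since this index may
    exceed \<open>N\<close> in absolute value.\<close>
  have 1: "(\<Sum>n\<in>?I. of_bool (l + m - n = j) * (A * weight p l * (B * weight p m) * (C * weight p n)))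
       \<le> A * B * C * (weight p l * (weight p m * weight p (j - l - m)))" for l m
  proof -
    have "(\<Sum>n\<in>?I. of_bool (l + m - n = j) * (A * weight p l * (B * weight p m) * (C * weight p n))) =
       (\<Sum>n\<in>?I. if n = l + m - j then A * weight p l * (B * weight p m) * (C * weight p n) else 0)"
      by (intro sum.cong) auto
    also have "\<dots> \<le> A * weight p l * (B * weight p m) * (C * weight p (l + m - j))"
      using nn by (simp add: sum.delta)
    also have "weight p (l + m - j) = weight p (j - l - m)"
      using weight_minus[of p "j - l - m"] by (simp add: algebra_simps)
    finally show ?thesis by (simp add: mult_ac)
  qed
  have "cmod (tri N a b c j) \<le> (\<Sum>l\<in>?I. \<Sum>m\<in>?I. \<Sum>n\<in>?I. of_bool (l + m - n = j) * (A * weight p l * (B * weight p m) * (C * weight p n)))"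
    unfolding tri_def
    by (intro sum_norm_le) (use a b c nn in \<open>auto simp: norm_mult weight_bounded_def intro!: mult_mono\<close>)
  also have "\<dots> \<le> (\<Sum>l\<in>?I. \<Sum>m\<in>?I. A * B * C * (weight p l * (weight p m * weight p (j - l - m))))"
    by (intro sum_mono 1)
  also have "\<dots> = (\<Sum>l\<in>?I. A * B * C * weight p l * (\<Sum>m\<in>?I. weight p m * weight p ((j - l) - m)))"
    by (simp add: sum_distrib_left mult.assoc)
  also have "\<dots> \<le> (\<Sum>l\<in>?I. A * B * C * weight p l * (?E * weight p (j - l)))"
    by (intro sum_mono mult_left_mono weight_convolution p mult_nonneg_nonneg nn weight_nonneg) auto
  also have "\<dots> = A * B * C * ?E * (\<Sum>l\<in>?I. weight p l * weight p (j - l))"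
    by (simp add: sum_distrib_left mult_ac)
  also have "\<dots> \<le> A * B * C * ?E * (?E * weight p j)"
    by (intro mult_left_mono weight_convolution p mult_nonneg_nonneg nn) auto
  finally show "cmod (tri N a b c j) \<le> ?E\<^sup>2 * (A * B * C) * weight p j"
    by (simp add: power2_eq_square mult_ac)
qed

lemma has_vector_derivative_tri:
  assumes a: "\<And>j. j \<in> {- int N..int N} \<Longrightarrow> ((\<lambda>t. a t j) has_vector_derivative a' j) (at t within S)"
    and b: "\<And>j. j \<in> {- int N..int N} \<Longrightarrow> ((\<lambda>t. b t j) has_vector_derivative b' j) (at t within S)"
    and c: "\<And>j. j \<in> {- int N..int N} \<Longrightarrow> ((\<lambda>t. c t j) has_vector_derivative c' j) (at t within S)"
  shows "((\<lambda>t. tri N (a t) (b t) (c t) j) has_vector_derivative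
     (tri N a' (b t) (c t) j + tri N (a t) b' (c t) j + tri N (a t) (b t) c' j)) (at t within S)"
proof -
  let ?I = "{- int N..int N}"
  have "((\<lambda>t. tri N (a t) (b t) (c t) j) has_vector_derivative
     (\<Sum>l\<in>?I. \<Sum>m\<in>?I. \<Sum>n\<in>?I. of_bool (l + m - n = j) *
        ((a t l * b t m) * cnj (c' n) + (a t l * b' m + a' l * b t m) * cnj (c t n)))) (at t within S)"
    unfolding tri_def
    by (intro has_vector_derivative_sum has_vector_derivative_mult_right has_vector_derivative_mult
       has_vector_derivative_cnj a b c)
  also have "(\<Sum>l\<in>?I. \<Sum>m\<in>?I. \<Sum>n\<in>?I. of_bool (l + m - n = j) *
        ((a t l * b t m) * cnj (c' n) + (a t l * b' m + a' l * b t m) * cnj (c t n))) =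
      tri N a' (b t) (c t) j + tri N (a t) b' (c t) j + tri N (a t) (b t) c' j"
    unfolding tri_def by (simp add: sum.distrib algebra_simps)
  finally show ?thesis .
qed

section \<open>Cost of the dispersion symbol in weights\<close>

abbreviation symb :: "real \<Rightarrow> int \<Rightarrow> real" where
  "symb s j \<equiv> \<bar>of_int j\<bar> powr (2 * s)"

text \<open>Because \<open>s \<le> 1\<close>, the symbol grows no faster than
  \<open>(1 + |j|)^2\<close>, which two orders of weight compensate.\<close>

lemma symb_weight_le:
  assumes "0 < s" "s \<le> 1"
  shows "symb s j * weight (p + 2) j \<le> weight p j"
proof -
  have "symb s j \<le> (1 + \<bar>of_int j\<bar>) powr (2 * s)" using assms by (intro powr_mono2) auto
  also have "\<dots> \<le> (1 + \<bar>of_int j\<bar>) powr 2" using assms by (intro powr_mono) auto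
  also have "\<dots> = (1 + \<bar>of_int j\<bar>)\<^sup>2" by (simp add: powr_numeral)
  finally have "symb s j * weight (p + 2) j \<le> (1 + \<bar>of_int j\<bar>)\<^sup>2 * weight (p + 2) j"
    by (rule mult_right_mono) simp
  also have "\<dots> = weight p j"
  proof -
    have "1 + \<bar>real_of_int j\<bar> \<noteq> 0" using abs_ge_zero[of "real_of_int j"] by linarith
    thus ?thesis unfolding weight_add by (simp add: weight_def)
  qed
  finally show ?thesis .
qed

lemma weight_bounded_symb:
  assumes "0 < s" "s \<le> 1" "weight_bounded N (p + 2) K a" "K \<ge> 0"
  shows "weight_bounded N p K (\<lambda>j. - \<i> * of_real (symb s j) * a j)"
  unfolding weight_bounded_def
proof
  fix j assume "j \<in> {- int N..int N}"
  hence "symb s j * cmod (a j) \<le> symb s j * (K * weight (p + 2) j)"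
    using assms by (intro mult_left_mono) (auto simp: weight_bounded_def)
  also have "\<dots> = K * (symb s j * weight (p + 2) j)" by simp
  also have "\<dots> \<le> K * weight p j" using assms by (intro mult_left_mono symb_weight_le)
  finally show "cmod (- \<i> * of_real (symb s j) * a j) \<le> K * weight p j"
    by (simp add: norm_mult)
qed

section \<open>Trapezoidal rule and Gronwall inequality\<close>

text \<open>The error is regarded as a function \<open>\<phi>\<close> of the right end point. It
  vanishes at \<open>a\<close>, and so does its derivative \<open>\<psi>\<close>, whose own
  derivative is \<open>- ((t - a) / 2) *\<^sub>R f3 t\<close>. Two mean value inequalities give the
  factor 1/2, in place of the sharp 1/12.\<close>

lemma trapezoidal_remainder:
  fixes f :: "real \<Rightarrow> complex"
  assumes f: "\<And>t. t \<in> {a..b} \<Longrightarrow> (f has_vector_derivative f1 t) (at t within {a..b})"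
    and f1: "\<And>t. t \<in> {a..b} \<Longrightarrow> (f1 has_vector_derivative f2 t) (at t within {a..b})"
    and f2: "\<And>t. t \<in> {a..b} \<Longrightarrow> (f2 has_vector_derivative f3 t) (at t within {a..b})"
    and G: "\<And>t. t \<in> {a..b} \<Longrightarrow> cmod (f3 t) \<le> G" and ab: "a \<le> b"
  shows "cmod (f b - f a - ((b - a) / 2) *\<^sub>R (f1 a + f1 b)) \<le> G * (b - a) ^ 3 / 2"
proof -
  define \<phi> where "\<phi> = (\<lambda>x. f x - f a - ((x - a) / 2) *\<^sub>R (f1 a + f1 x))"
  define \<psi> where "\<psi> = (\<lambda>x. (1/2) *\<^sub>R (f1 x - f1 a) - ((x - a) / 2) *\<^sub>R f2 x)"
  have d\<phi>: "(\<phi> has_vector_derivative \<psi> t) (at t within {a..b})" if "t \<in> {a..b}" for t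
    unfolding \<phi>_def \<psi>_def
    by (rule derivative_eq_intros f[OF that] f1[OF that] refl | simp)+
      (simp add: scaleR_conv_of_real field_simps)
  have d\<psi>: "(\<psi> has_vector_derivative (- ((t - a) / 2) *\<^sub>R f3 t)) (at t within {a..b})" if "t \<in> {a..b}" for t
    unfolding \<psi>_def
    by (rule derivative_eq_intros f1[OF that] f2[OF that] refl | simp)+
  have b\<psi>: "cmod (\<psi> t) \<le> G * (b - a)\<^sup>2 / 2" if t: "t \<in> {a..b}" for t
  proof -
    have G0: "G \<ge> 0" using G[OF t] norm_ge_zero order_trans by blast
    have "cmod (\<psi> t - \<psi> a) \<le> ((b - a) / 2 * G) * \<bar>t - a\<bar>"
    proof (rule norm_diff_le_vector_derivative[OF d\<psi>])
      fix \<tau> assume "\<tau> \<in> {a..b}"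
      thus "cmod ((- ((\<tau> - a) / 2)) *\<^sub>R f3 \<tau>) \<le> (b - a) / 2 * G"
        using G[of \<tau>] unfolding norm_scaleR by (intro mult_mono) auto
    qed (use t in auto)
    also have "\<dots> \<le> ((b - a) / 2 * G) * (b - a)" using t G0 by (intro mult_left_mono) auto
    finally show ?thesis by (simp add: \<psi>_def power2_eq_square mult_ac)
  qed
  have "cmod (\<phi> b - \<phi> a) \<le> (G * (b - a)\<^sup>2 / 2) * \<bar>b - a\<bar>"
    using ab by (intro norm_diff_le_vector_derivative[OF d\<phi> b\<psi>]) auto
  thus ?thesis using ab by (simp add: \<phi>_def power3_eq_cube power2_eq_square mult_ac)
qed

section \<open>Gronwall inequality and continuation argument\<close>

lemma gronwall:
  fixes y y' :: "real \<Rightarrow> real"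
  assumes "0 \<le> b" "continuous_on {0..b} y" "y 0 = 0"
    and d: "\<And>t. 0 < t \<Longrightarrow> t < b \<Longrightarrow> (y has_real_derivative y' t) (at t)"
    and le: "\<And>t. 0 < t \<Longrightarrow> t < b \<Longrightarrow> y' t \<le> K * (y t + \<delta>)"
  shows "y b + \<delta> \<le> \<delta> * exp (K * b)"
proof -
  \<comment> \<open>The integrating factor \<open>exp (- K * t)\<close> turns the differential
    inequality into monotonicity.\<close>
  have "(y b + \<delta>) * exp (- K * b) \<le> (y 0 + \<delta>) * exp (- K * 0)"
  proof (rule DERIV_nonpos_imp_decreasing_open[OF assms(1)])
    fix t assume t: "0 < t" "t < b"
    have "((\<lambda>t. (y t + \<delta>) * exp (- K * t)) has_real_derivative (y' t - K * (y t + \<delta>)) * exp (- K * t)) (at t)"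
      by (rule derivative_eq_intros d[OF t] refl | simp)+ (simp add: algebra_simps)
    moreover have "(y' t - K * (y t + \<delta>)) * exp (- K * t) \<le> 0"
      using le[OF t] by (simp add: mult_nonpos_nonneg)
    ultimately show "\<exists>z. ((\<lambda>t. (y t + \<delta>) * exp (- K * t)) has_real_derivative z) (at t) \<and> z \<le> 0" by blast
  qed (intro continuous_intros assms)
  hence "(y b + \<delta>) * exp (- K * b) * exp (K * b) \<le> \<delta> * exp (K * b)"
    using assms(3) by (intro mult_right_mono) auto
  thus ?thesis by (simp add: mult.assoc exp_add[symmetric])
qed

text \<open>The differential inequality is only available while \<open>y\<close> stays below \<open>\<eta>\<close>; at the first time
  \<open>y\<close> reaches \<open>\<eta>\<close>, Gronwall's inequality would still keep it strictly below.\<close>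

lemma bootstrap_gronwall:
  fixes y y' :: "real \<Rightarrow> real"
  assumes "continuous_on {0..T} y" "y 0 = 0" "0 < \<delta>" "0 \<le> K" "\<delta> * exp (K * T) < \<eta>"
    and d: "\<And>t. 0 < t \<Longrightarrow> t < T \<Longrightarrow> (y has_real_derivative y' t) (at t)"
    and le: "\<And>t. 0 < t \<Longrightarrow> t < T \<Longrightarrow> y t < \<eta> \<Longrightarrow> y' t \<le> K * (y t + \<delta>)"
    and t: "t \<in> {0..T}"
  shows "y t \<le> \<delta> * exp (K * T)"
proof -
  have *: "y b \<le> \<delta> * exp (K * T)" if "b \<in> {0..T}" "\<And>t. 0 < t \<Longrightarrow> t < b \<Longrightarrow> y t < \<eta>" for b
  proof -
    have "y b + \<delta> \<le> \<delta> * exp (K * b)"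
      using that by (intro gronwall[of b y y' K \<delta>] d le continuous_on_subset[OF assms(1)] assms(2)) auto
    also have "\<dots> \<le> \<delta> * exp (K * T)" using that assms by (simp add: mult_left_mono)
    finally show ?thesis using assms by simp
  qed
  \<comment> \<open>The times at which \<open>y\<close> has reached \<open>\<eta>\<close>. If there
    are any, closedness of \<open>S\<close> makes its infimum the first one; \<open>*\<close>
    applies up to that time and contradicts membership in \<open>S\<close>.\<close>
  define S where "S = {0..T} \<inter> y -` {\<eta>..}"
  have "S = {}"
  proof (rule ccontr)
    assume ne: "S \<noteq> {}"
    have cl: "closed S" unfolding S_def Int_commute[of "{0..T}"] by (rule closed_vimage_Int[OF _ assms(1)]) auto
    have bb: "bdd_below S" unfolding S_def by (auto intro!: bdd_belowI[where m = 0])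
    have m: "Inf S \<in> S" by (rule closed_contains_Inf[OF ne bb cl])
    have "y (Inf S) \<le> \<delta> * exp (K * T)"
    proof (rule *)
      show "Inf S \<in> {0..T}" using m by (simp add: S_def)
      fix t assume "0 < t" "t < Inf S"
      hence "t \<notin> S" using cInf_lower[OF _ bb] by force
      thus "y t < \<eta>" using \<open>0 < t\<close> \<open>t < Inf S\<close> m by (auto simp: S_def)
    qed
    thus False using m assms(5) by (simp add: S_def)
  qed
  thus ?thesis using t by (intro *) (auto simp: S_def not_le disjoint_iff)
qed

section \<open>The semidiscrete flow\<close>

lemma has_real_derivative_cmod_sq:
  assumes "(f has_vector_derivative f') (at t within S)"
  shows "((\<lambda>t. (cmod (f t))\<^sup>2) has_real_derivative 2 * Re (f' * cnj (f t))) (at t within S)"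
proof -
  have "((\<lambda>t. Re (f t * cnj (f t))) has_vector_derivative Re (f t * cnj f' + f' * cnj (f t))) (at t within S)"
    by (intro bounded_linear.has_vector_derivative[OF bounded_linear_Re] has_vector_derivative_mult has_vector_derivative_cnj assms)
  moreover have "Re (f t * cnj (f t)) = (cmod (f t))\<^sup>2" for t
    by (simp add: complex_norm_square[symmetric] del: of_real_power)
  ultimately show ?thesis
    by (simp add: has_real_derivative_iff_has_vector_derivative algebra_simps)
qed

lemma has_real_derivative_sum_cmod_sq:
  assumes "\<And>j. j \<in> A \<Longrightarrow> ((\<lambda>t. f t j) has_vector_derivative f' j) (at t within S)"
  shows "((\<lambda>t. \<Sum>j\<in>A. (cmod (f t j))\<^sup>2) has_real_derivative 2 * Re (\<Sum>j\<in>A. f' j * cnj (f t j))) (at t within S)"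
proof -
  have "((\<lambda>t. \<Sum>j\<in>A. (cmod (f t j))\<^sup>2) has_real_derivative (\<Sum>j\<in>A. 2 * Re (f' j * cnj (f t j)))) (at t within S)"
    by (intro DERIV_sum has_real_derivative_cmod_sq assms)
  thus ?thesis by (simp only: Re_sum sum_distrib_left)
qed

text \<open>The vector field \<open>F\<close> written on Fourier coefficients. The projection
  \<open>P_N\<close> leaves no trace, as only the indices up to \<open>N\<close> are ever read
  off.\<close>

definition flow :: "real \<Rightarrow> nat \<Rightarrow> (int \<Rightarrow> complex) \<Rightarrow> int \<Rightarrow> complex" where
  "flow s N a j = - \<i> * of_real (symb s j) * a j + \<i> * tri N a a a j"

lemma semidiscrete_rhs_flow: "semidiscrete_rhs s N (trig_poly N c) = trig_poly N (flow s N c)"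
  unfolding semidiscrete_rhs_trig_poly fourier_coeff_cub flow_def[abs_def] ..

text \<open>The symbol is real, so every summand is purely imaginary.\<close>

lemma Re_dispersion_zero: "Re (\<Sum>j\<in>A. - \<i> * of_real (symb s j) * a j * cnj (a j)) = 0"
proof -
  have "- \<i> * of_real (symb s j) * a j * cnj (a j) = - \<i> * of_real (symb s j * (cmod (a j))\<^sup>2)" for j
    by (simp add: complex_norm_square del: of_real_power)
  thus ?thesis by (simp del: of_real_mult of_real_power)
qed

text \<open>The cubic term paired with \<open>a\<close> is the mean of the fourth power of the
  modulus, hence real, and the factor \<open>\<i>\<close> makes it imaginary. This one identity
  yields conservation of mass both for the flow and for the midpoint rule.\<close>

lemma Re_flow_zero: "Re (\<Sum>j\<in>{- int N..int N}. flow s N a j * cnj (a j)) = 0"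
proof -
  have i: "(\<lambda>x. (cmod (trig_poly N a x)) ^ 4) integrable_on {-pi..pi}"
    by (intro integrable_on_continuous_UNIV continuous_intros)
  have "(\<Sum>j\<in>{- int N..int N}. tri N a a a j * cnj (a j)) =
      (1 / (2 * pi)) *\<^sub>R integral {-pi..pi} (\<lambda>x. cub (trig_poly N a x) * cnj (trig_poly N a x))"
    unfolding fourier_coeff_cub[symmetric] by (rule fourier_coeff_pairing) (intro continuous_intros)
  also have "(\<lambda>x. cub (trig_poly N a x) * cnj (trig_poly N a x)) = (\<lambda>x. of_real ((cmod (trig_poly N a x)) ^ 4))"
  proof
    fix x
    have "cub z * cnj z = of_real ((cmod z) ^ 4)" for z
      by (simp only: mult.assoc complex_norm_square[symmetric] of_real_mult[symmetric]) (simp add: power2_eq_square eval_nat_numeral)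
    thus "cub (trig_poly N a x) * cnj (trig_poly N a x) = of_real ((cmod (trig_poly N a x)) ^ 4)" .
  qed
  also have "integral {-pi..pi} (\<lambda>x. complex_of_real ((cmod (trig_poly N a x)) ^ 4)) =
       of_real (integral {-pi..pi} (\<lambda>x. (cmod (trig_poly N a x)) ^ 4))"
    using integral_linear[OF i bounded_linear_of_real[where 'a = complex]] by (simp add: o_def)
  finally have "Im (\<Sum>j\<in>{- int N..int N}. tri N a a a j * cnj (a j)) = 0" by simp
  hence "Re (\<Sum>j\<in>{- int N..int N}. \<i> * tri N a a a j * cnj (a j)) = 0"
    by (simp add: mult.assoc sum_distrib_left[symmetric] del: Re_sum Im_sum)
  moreover have "(\<Sum>j\<in>{- int N..int N}. flow s N a j * cnj (a j)) =
      (\<Sum>j\<in>{- int N..int N}. - \<i> * of_real (symb s j) * a j * cnj (a j)) +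
      (\<Sum>j\<in>{- int N..int N}. \<i> * tri N a a a j * cnj (a j))"
    by (simp only: flow_def distrib_right sum.distrib)
  ultimately show ?thesis using Re_dispersion_zero[where A = "{- int N..int N}" and s = s and a = a]
    by (simp del: Re_sum)
qed

text \<open>Passage from the equation for functions to a system of ordinary differential equations
  for finitely many coefficients, on which the later estimates are based.\<close>

lemma semidiscrete_solution_coeffs:
  assumes "semidiscrete_solution s N T u0 uN" "T > 0"
  defines "c \<equiv> \<lambda>t. fourier_coeff (uN t)"
  shows "\<And>t. t \<in> {0..T} \<Longrightarrow> uN t = trig_poly N (c t)"
    and "\<And>t j. t \<in> {0..T} \<Longrightarrow> j \<in> {- int N..int N} \<Longrightarrow>
      ((\<lambda>\<tau>. c \<tau> j) has_vector_derivative flow s N (c t) j) (at t within {0..T})"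
    and "\<And>j. j \<in> {- int N..int N} \<Longrightarrow> c 0 j = fourier_coeff u0 j"
proof -
  show eq: "uN t = trig_poly N (c t)" if "t \<in> {0..T}" for t
    using assms(1) that unfolding c_def semidiscrete_solution_def by (intro trig_poly_fourier_coeff) auto
  show "((\<lambda>\<tau>. c \<tau> j) has_vector_derivative flow s N (c t) j) (at t within {0..T})"
    if t: "t \<in> {0..T}" and j: "j \<in> {- int N..int N}" for t j
  proof (rule has_vector_derivative_coeff[OF _ j])
    fix x
    have "((\<lambda>\<tau>. uN \<tau> x) has_vector_derivative trig_poly N (flow s N (c t)) x) (at t within {0..T})"
      using assms(1) t unfolding semidiscrete_solution_def semidiscrete_rhs_flow[symmetric] eq[OF t, symmetric] by auto
    thus "((\<lambda>\<tau>. trig_poly N (c \<tau>) x) has_vector_derivative trig_poly N (flow s N (c t)) x) (at t within {0..T})"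
      by (rule has_vector_derivative_transform[OF t, rotated]) (simp add: eq)
  qed
  show "c 0 j = fourier_coeff u0 j" if "j \<in> {- int N..int N}" for j
    using assms(1) that by (simp add: c_def semidiscrete_solution_def fourier_proj_eq fourier_coeff_trig_poly)
qed

lemma flow_mass_conserved:
  assumes "\<And>t j. t \<in> {0..T} \<Longrightarrow> j \<in> {- int N..int N} \<Longrightarrow>
      ((\<lambda>\<tau>. c \<tau> j) has_vector_derivative flow s N (c t) j) (at t within {0..T})" "t \<in> {0..T}"
  shows "(\<Sum>j\<in>{- int N..int N}. (cmod (c t j))\<^sup>2) = (\<Sum>j\<in>{- int N..int N}. (cmod (c 0 j))\<^sup>2)"
proof -
  have "((\<lambda>t. \<Sum>j\<in>{- int N..int N}. (cmod (c t j))\<^sup>2) has_real_derivative 0) (at t within {0..T})"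
    if "t \<in> {0..T}" for t
    using has_real_derivative_sum_cmod_sq[of "{- int N..int N}" c, OF assms(1)[OF that]] by (simp only: Re_flow_zero mult_zero_right)
  then obtain C where "\<And>t. t \<in> {0..T} \<Longrightarrow> (\<Sum>j\<in>{- int N..int N}. (cmod (c t j))\<^sup>2) = C"
    using has_field_derivative_zero_constant[of "{0..T}" "\<lambda>t. \<Sum>j\<in>{- int N..int N}. (cmod (c t j))\<^sup>2"] by auto
  from this[OF assms(2)] this[of 0] show ?thesis using assms(2) by simp
qed

text \<open>The weight exponent drops from 8 through 6 and 4 to 2 along three time derivatives; 2 is
  still enough for the weights to be summable. \<open>L\<close> is fixed before \<open>N\<close>,
  \<open>T\<close> and \<open>c\<close>, so it depends on \<open>s\<close> and \<open>K\<close> at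
  most.\<close>

lemma flow_time_derivatives:
  assumes s: "0 < s" "s \<le> 1" and K: "K \<ge> 0"
  shows "\<exists>L\<ge>0. \<forall>N T c.
     (\<forall>t\<in>{0..T}. \<forall>j\<in>{- int N..int N}.
        ((\<lambda>\<tau>. c \<tau> j) has_vector_derivative flow s N (c t) j) (at t within {0..T})) \<longrightarrow>
     (\<forall>t\<in>{0..T}. weight_bounded N 8 K (c t)) \<longrightarrow>
     (\<exists>c2 c3. \<forall>t\<in>{0..T}.
        (\<forall>j\<in>{- int N..int N}.
          ((\<lambda>\<tau>. flow s N (c \<tau>) j) has_vector_derivative c2 t j) (at t within {0..T}) \<and>
          ((\<lambda>\<tau>. c2 \<tau> j) has_vector_derivative c3 t j) (at t within {0..T})) \<and>
        weight_bounded N 6 L (flow s N (c t)) \<and> weight_bounded N 2 L (c3 t))"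
proof -
  define E where "E p = (6 * 2 ^ p :: real)\<^sup>2" for p :: nat
  have E: "E p \<ge> 0" for p by (simp add: E_def)
  \<comment> \<open>\<open>E p\<close> is the constant of \<open>weight_bounded_tri\<close>.
    \<open>K1\<close>, \<open>K2\<close> and \<open>K3\<close> repeat the product rule term by term:
    one cubic term in the first derivative, three in the second, nine in the third.\<close>
  define K1 where "K1 = K + E 6 * (K * K * K)"
  have K1: "K1 \<ge> 0" using K E by (simp add: K1_def)
  define K2 where "K2 = K1 + E 4 * (K1 * K * K + K * K1 * K + K * K * K1)"
  have K2: "K2 \<ge> 0" using K K1 E by (simp add: K2_def)
  define K3 where "K3 = K2 + E 2 * ((K2 * K * K + K1 * K1 * K + K1 * K * K1) +
     (K1 * K1 * K + K * K2 * K + K * K1 * K1) + (K1 * K * K1 + K * K1 * K1 + K * K * K2))"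
  have K3: "K3 \<ge> 0" using K K1 K2 E by (simp add: K3_def)
  show ?thesis
  proof (intro exI[of _ "max K1 K3"] conjI allI impI)
    show "0 \<le> max K1 K3" using K1 by simp
    fix N T and c :: "real \<Rightarrow> int \<Rightarrow> complex"
    assume "\<forall>t\<in>{0..T}. \<forall>j\<in>{- int N..int N}.
        ((\<lambda>\<tau>. c \<tau> j) has_vector_derivative flow s N (c t) j) (at t within {0..T})"
    hence dc: "((\<lambda>\<tau>. c \<tau> j) has_vector_derivative flow s N (c t) j) (at t within {0..T})"
      if "t \<in> {0..T}" "j \<in> {- int N..int N}" for t j using that by blast
    assume "\<forall>t\<in>{0..T}. weight_bounded N 8 K (c t)"
    hence bc: "weight_bounded N 8 K (c t)" if "t \<in> {0..T}" for t using that by blast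
    define b where "b t = flow s N (c t)" for t
    define c2 where "c2 t j = - \<i> * of_real (symb s j) * b t j + \<i> *
      (tri N (b t) (c t) (c t) j + tri N (c t) (b t) (c t) j + tri N (c t) (c t) (b t) j)" for t j
    define c3 where "c3 t j = - \<i> * of_real (symb s j) * c2 t j + \<i> *
      ((tri N (c2 t) (c t) (c t) j + tri N (b t) (b t) (c t) j + tri N (b t) (c t) (b t) j) +
       (tri N (b t) (b t) (c t) j + tri N (c t) (c2 t) (c t) j + tri N (c t) (b t) (b t) j) +
       (tri N (b t) (c t) (b t) j + tri N (c t) (b t) (b t) j + tri N (c t) (c t) (c2 t) j))" for t j
    have db: "((\<lambda>\<tau>. b \<tau> j) has_vector_derivative c2 t j) (at t within {0..T})"
      if tj: "t \<in> {0..T}" "j \<in> {- int N..int N}" for t j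
    proof -
      have "((\<lambda>\<tau>. - \<i> * of_real (symb s j) * c \<tau> j + \<i> * tri N (c \<tau>) (c \<tau>) (c \<tau>) j)
          has_vector_derivative c2 t j) (at t within {0..T})"
        unfolding c2_def
        by (intro has_vector_derivative_add has_vector_derivative_mult_right has_vector_derivative_tri
            dc[folded b_def] tj)
      thus ?thesis unfolding b_def flow_def .
    qed
    have dc2: "((\<lambda>\<tau>. c2 \<tau> j) has_vector_derivative c3 t j) (at t within {0..T})"
      if tj: "t \<in> {0..T}" "j \<in> {- int N..int N}" for t j
    proof -
      have "((\<lambda>\<tau>. - \<i> * of_real (symb s j) * b \<tau> j + \<i> *
          (tri N (b \<tau>) (c \<tau>) (c \<tau>) j + tri N (c \<tau>) (b \<tau>) (c \<tau>) j + tri N (c \<tau>) (c \<tau>) (b \<tau>) j))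
          has_vector_derivative c3 t j) (at t within {0..T})"
        unfolding c3_def
        by (intro has_vector_derivative_add has_vector_derivative_mult_right has_vector_derivative_tri
            db dc[folded b_def] tj)
      thus ?thesis unfolding c2_def .
    qed
    show "\<exists>c2 c3. \<forall>t\<in>{0..T}.
        (\<forall>j\<in>{- int N..int N}.
          ((\<lambda>\<tau>. flow s N (c \<tau>) j) has_vector_derivative c2 t j) (at t within {0..T}) \<and>
          ((\<lambda>\<tau>. c2 \<tau> j) has_vector_derivative c3 t j) (at t within {0..T})) \<and>
        weight_bounded N 6 (max K1 K3) (flow s N (c t)) \<and> weight_bounded N 2 (max K1 K3) (c3 t)"
    proof (intro exI ballI conjI)
      fix t assume t: "t \<in> {0..T}"
      have c: "weight_bounded N p K (c t)" if "p \<le> 8" for p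
        by (rule weight_bounded_mono[OF bc[OF t] that K])
      have "weight_bounded N 6 K1 (b t)"
        unfolding b_def flow_def[abs_def] K1_def E_def
        by (intro weight_bounded_add weight_bounded_symb weight_bounded_i_mult weight_bounded_tri c s K) auto
      hence b: "weight_bounded N p K1 (b t)" if "p \<le> 6" for p
        by (rule weight_bounded_mono[OF _ that K1])
      have "weight_bounded N 4 K2 (c2 t)"
        unfolding c2_def[abs_def] K2_def E_def distrib_left
        by (intro weight_bounded_add weight_bounded_symb weight_bounded_i_mult weight_bounded_tri b c s K K1) auto
      hence c2: "weight_bounded N p K2 (c2 t)" if "p \<le> 4" for p
        by (rule weight_bounded_mono[OF _ that K2])
      have c3: "weight_bounded N 2 K3 (c3 t)"
        unfolding c3_def[abs_def] K3_def E_def distrib_left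
        by (intro weight_bounded_add weight_bounded_symb weight_bounded_i_mult weight_bounded_tri b c c2 s K K1 K2) auto
      have max: "weight_bounded N p (max K1 K3) a" if "weight_bounded N p k a" "k \<le> max K1 K3" for p k a
        using that(1) mult_right_mono[OF that(2) weight_nonneg]
        unfolding weight_bounded_def by (meson order_trans)
      show "weight_bounded N 6 (max K1 K3) (flow s N (c t))" using max[OF b[of 6]] by (simp add: b_def)
      show "weight_bounded N 2 (max K1 K3) (c3 t)" using max[OF c3] by simp
      fix j assume j: "j \<in> {- int N..int N}"
      show "((\<lambda>\<tau>. flow s N (c \<tau>) j) has_vector_derivative c2 t j) (at t within {0..T})"
        using db[OF t j] by (simp add: b_def)
      show "((\<lambda>\<tau>. c2 \<tau> j) has_vector_derivative c3 t j) (at t within {0..T})" by (rule dc2[OF t j])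
    qed
  qed
qed

section \<open>Uniform regularity of the semidiscrete solution\<close>

text \<open>A single term of the Sobolev sum is bounded by the whole sum, and
  \<open>(1 + |j|)^2\<close> is at most \<open>2 * (1 + j^2)\<close>.\<close>

lemma sobolev_coeff_le:
  assumes "f \<in> sobolev_space \<mu>" "sobolev_norm \<mu> f \<le> B" "real p \<le> \<mu>"
  shows "cmod (fourier_coeff f j) \<le> 2 ^ p * B * weight p j"
proof -
  let ?w = "\<lambda>j::int. (1 + (of_int j)\<^sup>2) powr \<mu> * (cmod (fourier_coeff f j))\<^sup>2"
  have sm: "?w summable_on UNIV" using assms(1) by (simp add: sobolev_space_def)
  have "0 \<le> sobolev_norm \<mu> f" unfolding sobolev_norm_def by (simp add: infsum_nonneg)
  hence B: "B \<ge> 0" using assms(2) by linarith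
  have "?w j = infsum ?w {j}" by simp
  also have "\<dots> \<le> infsum ?w UNIV" by (rule infsum_mono2) (use sm in auto)
  also have "\<dots> \<le> B\<^sup>2" using assms(2) by (simp add: sobolev_norm_def sqrt_le_D)
  finally have w: "?w j \<le> B\<^sup>2" .
  define a where "a = 1 + \<bar>real_of_int j\<bar>"
  have a: "a \<ge> 1" by (simp add: a_def)
  have "a\<^sup>2 \<le> 2 * (1 + (real_of_int j)\<^sup>2)"
    using zero_le_power2[of "\<bar>real_of_int j\<bar> - 1"] by (simp add: a_def power2_eq_square algebra_simps)
  hence "(a\<^sup>2 / 2) ^ p \<le> (1 + (real_of_int j)\<^sup>2) ^ p" by (intro power_mono) auto
  also have "\<dots> = (1 + (real_of_int j)\<^sup>2) powr real p" by (simp add: powr_realpow add_pos_nonneg)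
  also have "\<dots> \<le> (1 + (real_of_int j)\<^sup>2) powr \<mu>" using assms(3) by (intro powr_mono) auto
  finally have "(a\<^sup>2 / 2) ^ p * (cmod (fourier_coeff f j))\<^sup>2 \<le> ?w j"
    by (rule mult_right_mono) simp
  hence "(a\<^sup>2 / 2) ^ p * (cmod (fourier_coeff f j))\<^sup>2 \<le> B\<^sup>2" using w by linarith
  hence "(a ^ p * cmod (fourier_coeff f j))\<^sup>2 \<le> 2 ^ p * B\<^sup>2"
    by (simp add: power_divide power_mult_distrib field_simps power_mult[symmetric])
  \<comment> \<open>The factor \<open>2 ^ p\<close> is enlarged to a perfect square before the root
    is taken.\<close>
  also have "\<dots> \<le> 2 ^ (2 * p) * B\<^sup>2" by (intro mult_right_mono power_increasing) auto
  also have "\<dots> = (2 ^ p * B)\<^sup>2" by (simp add: power_mult_distrib power_mult[symmetric] mult.commute)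
  finally have "a ^ p * cmod (fourier_coeff f j) \<le> 2 ^ p * B"
    using B by (auto dest: power2_le_imp_le)
  thus ?thesis using a by (simp add: weight_def a_def[symmetric] field_simps)
qed

lemma abs_summable_weight:
  assumes "\<And>j. cmod (a j) \<le> K * weight p j" "p \<ge> 2"
  shows "(\<lambda>j. cmod (a j)) summable_on A"
  by (rule summable_on_comparison_test[of "\<lambda>j. K * weight p j"])
    (use assms in \<open>auto intro!: summable_on_cmult_right weight_summable_on\<close>)

lemma infsum_norm_weight_le:
  assumes "\<And>j. cmod (a j) \<le> K * weight p j" "p \<ge> 2" "K \<ge> 0"
  shows "(\<Sum>\<^sub>\<infinity>j. cmod (a j)) \<le> 3 * K"
proof -
  have "(\<Sum>\<^sub>\<infinity>j. cmod (a j)) \<le> (\<Sum>\<^sub>\<infinity>j. K * weight p j)"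
    by (intro infsum_mono abs_summable_weight[OF assms(1,2)] summable_on_cmult_right weight_summable_on assms)
  also have "\<dots> = K * infsum (weight p) UNIV" by (rule infsum_cmult_right')
  also have "\<dots> \<le> K * 3" by (intro mult_left_mono infsum_weight_le assms)
  finally show ?thesis by simp
qed

text \<open>The difference splits into \<open>|a|^2 (a - b)\<close> and
  \<open>(|a|^2 - |b|^2) b\<close>; the first contributes one and the second two of the three copies
  of \<open>m\<^sup>2\<close>.\<close>

lemma cub_diff_le:
  assumes "cmod a \<le> m" "cmod b \<le> m"
  shows "cmod (cub a - cub b) \<le> 3 * m\<^sup>2 * cmod (a - b)"
proof -
  have "cub a - cub b = of_real ((cmod a)\<^sup>2) * (a - b) + of_real ((cmod a - cmod b) * (cmod a + cmod b)) * b"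
    by (simp add: power2_eq_square algebra_simps)
  also have "cmod \<dots> \<le> (cmod a)\<^sup>2 * cmod (a - b) + (\<bar>cmod a - cmod b\<bar> * (cmod a + cmod b)) * cmod b"
    by (rule norm_triangle_le) (simp only: norm_mult norm_of_real abs_mult, simp)
  also have "\<dots> \<le> m\<^sup>2 * cmod (a - b) + (cmod (a - b) * (m + m)) * m"
    using assms norm_triangle_ineq3[of a b] order_trans[OF norm_ge_zero assms(1)]
    by (intro add_mono mult_mono power_mono mult_nonneg_nonneg add_nonneg_nonneg) auto
  also have "\<dots> = 3 * m\<^sup>2 * cmod (a - b)" by (simp add: power2_eq_square)
  finally show ?thesis .
qed

text \<open>Of the ten orders of decay, eight give the power of \<open>N\<close> beyond the cutoff,
  and two keep the tail summable.\<close>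

lemma fourier_series_tail:
  assumes a: "\<And>j. cmod (a j) \<le> K * weight 10 j" and K: "K \<ge> 0" and N: "N \<ge> 1"
  shows "cmod (fourier_series a x - trig_poly N a x) \<le> 3 * (K / real N ^ 8)"
proof -
  let ?I = "{- int N..int N}"
  define a1 where "a1 j = (if j \<in> ?I then a j else 0)" for j
  define a2 where "a2 j = (if j \<in> ?I then 0 else a j)" for j
  have b1: "cmod (a1 j) \<le> K * weight 10 j" and b2: "cmod (a2 j) \<le> K * weight 10 j" for j
    using a K by (auto simp: a1_def a2_def)
  have sum: "(\<lambda>j. b j * cis (of_int j * x)) summable_on UNIV" if "\<And>j. cmod (b j) \<le> K * weight 10 j" for b
    using abs_summable_summable[of "\<lambda>j. b j * cis (of_int j * x)" UNIV] abs_summable_weight[OF that, of UNIV]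
    by (simp add: norm_mult)
  have "fourier_series a x = (\<Sum>\<^sub>\<infinity>j. a1 j * cis (of_int j * x) + a2 j * cis (of_int j * x))"
    unfolding fourier_series_def by (rule infsum_cong) (simp add: a1_def a2_def)
  also have "\<dots> = (\<Sum>\<^sub>\<infinity>j. a1 j * cis (of_int j * x)) + fourier_series a2 x"
    unfolding fourier_series_def by (intro infsum_add sum b1 b2)
  also have "(\<Sum>\<^sub>\<infinity>j. a1 j * cis (of_int j * x)) = (\<Sum>\<^sub>\<infinity>j\<in>?I. a j * cis (of_int j * x))"
    by (rule infsum_cong_neutral) (auto simp: a1_def)
  also have "\<dots> = trig_poly N a x" by (simp add: trig_poly_def)
  finally have "fourier_series a x - trig_poly N a x = fourier_series a2 x" by simp
  also have "cmod \<dots> \<le> (\<Sum>\<^sub>\<infinity>j. cmod (a2 j))"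
    by (rule norm_fourier_series_le[OF abs_summable_weight[OF b2]]) simp
  also have "\<dots> \<le> 3 * (K / real N ^ 8)"
  proof (rule infsum_norm_weight_le)
    fix j
    show "cmod (a2 j) \<le> K / real N ^ 8 * weight 2 j"
    proof (cases "j \<in> ?I")
      case False
      have "real N ^ 8 \<le> (1 + \<bar>real_of_int j\<bar>) ^ 8" using False by (intro power_mono) auto
      hence "weight 8 j \<le> 1 / real N ^ 8" using N unfolding weight_def by (intro divide_left_mono mult_pos_pos) auto
      hence "weight 2 j * weight 8 j \<le> weight 2 j * (1 / real N ^ 8)" by (rule mult_left_mono) simp
      hence "weight 10 j \<le> weight 2 j / real N ^ 8" using weight_add[of 2 8 j] by simp
      from order_trans[OF b2[of j] mult_left_mono[OF this K]] show ?thesis by simp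
    qed (use K in \<open>simp add: a2_def\<close>)
  qed (use K in auto)
  finally show ?thesis .
qed

text \<open>The equation is only given pointwise. The decay of the coefficients makes the fractional
  Laplacian an absolutely convergent series, so the time derivative is continuous in
  \<open>x\<close> and bounded uniformly in \<open>t\<close>; it may then be taken under the
  coefficient integral.\<close>

lemma fnls_solution_coeffs:
  assumes s: "0 < s" "s \<le> 1" and sol: "fnls_solution s T u0 u" and K: "K \<ge> 0"
    and b: "\<And>t j. t \<in> {0..T} \<Longrightarrow> cmod (fourier_coeff (u t) j) \<le> K * weight 10 j"
    and t: "t \<in> {0..T}"
  shows "u t = fourier_series (fourier_coeff (u t))"
    and "((\<lambda>\<tau>. fourier_coeff (u \<tau>) j) has_vector_derivative
      (- \<i> * of_real (symb s j) * fourier_coeff (u t) j + \<i> * fourier_coeff (\<lambda>x. cub (u t x)) j)) (at t within {0..T})"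
proof -
  have cont: "continuous_on UNIV (u t)" and per: "periodic_2pi (u t)" if "t \<in> {0..T}" for t
    using sol that by (auto simp: fnls_solution_def)
  have sm: "(\<lambda>j. cmod (fourier_coeff (u t) j)) summable_on UNIV" if "t \<in> {0..T}" for t
    by (rule abs_summable_weight[OF b[OF that]]) simp
  have inv: "u t = fourier_series (fourier_coeff (u t))" if "t \<in> {0..T}" for t
    by (intro fourier_inversion cont per sm that)
  show "u t = fourier_series (fourier_coeff (u t))" by (rule inv[OF t])
  define A where "A t = fourier_series (\<lambda>j. of_real (symb s j) * fourier_coeff (u t) j)" for t
  have bA: "cmod (of_real (symb s j) * fourier_coeff (u t) j) \<le> K * weight 8 j" if "t \<in> {0..T}" for t j
  proof -
    have "symb s j * cmod (fourier_coeff (u t) j) \<le> symb s j * (K * weight 10 j)"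
      by (intro mult_left_mono b that) auto
    also have "\<dots> = K * (symb s j * weight (8 + 2) j)" by simp
    also have "\<dots> \<le> K * weight 8 j" by (intro mult_left_mono symb_weight_le s K)
    finally show ?thesis by (simp add: norm_mult)
  qed
  have smA: "(\<lambda>j. cmod (of_real (symb s j) * fourier_coeff (u t) j)) summable_on UNIV" if "t \<in> {0..T}" for t
    by (rule abs_summable_weight[OF bA[OF that]]) simp
  have cA: "continuous_on UNIV (A t)" if "t \<in> {0..T}" for t
    unfolding A_def by (rule continuous_fourier_series[OF smA[OF that]])
  define d where "d t x = - \<i> * A t x + \<i> * cub (u t x)" for t x
  have cd: "continuous_on UNIV (d t)" if "t \<in> {0..T}" for t
    unfolding d_def by (intro continuous_intros cA cont that)
  have fl: "frac_laplacian s (u t) = A t" for t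
    by (rule ext) (simp add: frac_laplacian_def A_def fourier_series_def)
  have eqn: "\<forall>t\<in>{0..T}. \<forall>x. \<exists>d. ((\<lambda>\<tau>. u \<tau> x) has_vector_derivative d) (at t within {0..T}) \<and>
        \<i> * d - A t x + cub (u t x) = 0"
    using sol unfolding fnls_solution_def fl by (elim conjE)
  have der: "((\<lambda>\<tau>. u \<tau> x) has_vector_derivative d t x) (at t within {0..T})" if tT: "t \<in> {0..T}" for t x
  proof -
    obtain e where e: "((\<lambda>\<tau>. u \<tau> x) has_vector_derivative e) (at t within {0..T})"
      "\<i> * e - A t x + cub (u t x) = 0"
      using bspec[OF eqn tT, rule_format, of x] by (elim exE conjE)
    \<comment> \<open>The equation determines the derivative that it asserts to exist.\<close>
    have "e = d t x - \<i> * (\<i> * e - A t x + cub (u t x))"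
      unfolding d_def by (simp add: algebra_simps)
    hence "e = d t x" by (simp only: e(2) mult_zero_right diff_zero)
    thus ?thesis using e(1) by simp
  qed
  have bd: "cmod (d t x) \<le> 3 * K + (3 * K) ^ 3" if "t \<in> {0..T}" for t x
  proof -
    have "cmod (u t x) \<le> 3 * K"
      by (subst inv[OF that], rule order_trans[OF norm_fourier_series_le[OF sm[OF that]] infsum_norm_weight_le[OF b[OF that] _ K]]) simp
    hence "cmod (cub (u t x)) \<le> (3 * K) ^ 3"
      using power_mono[of "cmod (u t x)" "3 * K" 3] by (simp add: norm_mult norm_power power2_eq_square power3_eq_cube)
    moreover have "cmod (A t x) \<le> 3 * K"
      unfolding A_def by (rule order_trans[OF norm_fourier_series_le[OF smA[OF that]] infsum_norm_weight_le[OF bA[OF that] _ K]]) simp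
    ultimately show ?thesis unfolding d_def
      using norm_triangle_ineq[of "- \<i> * A t x" "\<i> * cub (u t x)"] by (simp add: norm_mult)
  qed
  have "fourier_coeff (d t) j = - \<i> * of_real (symb s j) * fourier_coeff (u t) j + \<i> * fourier_coeff (\<lambda>x. cub (u t x)) j"
  proof -
    have c1: "continuous_on UNIV (\<lambda>x. cub (u t x))" by (intro continuous_intros cont t)
    have "fourier_coeff (d t) j = - \<i> * fourier_coeff (A t) j + \<i> * fourier_coeff (\<lambda>x. cub (u t x)) j"
      unfolding d_def[abs_def]
      using c1 cA[OF t] by (simp only: fourier_coeff_add fourier_coeff_mult_left continuous_on_mult continuous_on_const)
    thus ?thesis unfolding A_def fourier_coeff_fourier_series[OF smA[OF t]] by simp
  qed
  with has_vector_derivative_fourier_coeff[OF cont cd der bd t, where j = j]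
  show "((\<lambda>\<tau>. fourier_coeff (u \<tau>) j) has_vector_derivative
      (- \<i> * of_real (symb s j) * fourier_coeff (u t) j + \<i> * fourier_coeff (\<lambda>x. cub (u t x)) j)) (at t within {0..T})"
    by simp
qed

text \<open>The dispersive part is skew-adjoint, so only the cubic term produces energy.\<close>

lemma energy_production_le:
  assumes h: "continuous_on UNIV h" "\<And>x. cmod (h x) \<le> L * (cmod (trig_poly N e x) + \<tau>)" and L: "L \<ge> 0"
  shows "2 * Re (\<Sum>j\<in>{- int N..int N}. (- \<i> * of_real (symb s j) * e j + \<i> * fourier_coeff h j) * cnj (e j))
     \<le> 4 * L * ((\<Sum>j\<in>{- int N..int N}. (cmod (e j))\<^sup>2) + \<tau>\<^sup>2)"
proof -
  let ?I = "{- int N..int N}"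
  have "Re (\<Sum>j\<in>?I. (- \<i> * of_real (symb s j) * e j + \<i> * fourier_coeff h j) * cnj (e j)) =
      Re (\<Sum>j\<in>?I. - \<i> * of_real (symb s j) * e j * cnj (e j)) + Re (\<i> * (\<Sum>j\<in>?I. fourier_coeff h j * cnj (e j)))"
    by (simp only: distrib_right sum.distrib sum_distrib_left mult.assoc plus_complex.simps)
  also have "\<dots> = Re (\<i> * (\<Sum>j\<in>?I. fourier_coeff h j * cnj (e j)))"
    by (simp only: Re_dispersion_zero add_0)
  also have "\<dots> \<le> cmod (\<Sum>j\<in>?I. fourier_coeff h j * cnj (e j))"
    using complex_Re_le_cmod[of "\<i> * (\<Sum>j\<in>?I. fourier_coeff h j * cnj (e j))"] by (simp only: norm_mult norm_ii mult_1)
  also have "\<dots> \<le> (1 / (2 * pi)) * integral {-pi..pi} (\<lambda>x. L * (cmod (trig_poly N e x) + \<tau>) * cmod (trig_poly N e x))"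
    by (rule norm_fourier_coeff_pairing_le[OF h]) (intro continuous_intros)
  also have "\<dots> \<le> (1 / (2 * pi)) * integral {-pi..pi} (\<lambda>x. 2 * L * (cmod (trig_poly N e x))\<^sup>2 + L * \<tau>\<^sup>2)"
  proof (intro mult_left_mono integral_le integrable_on_continuous_UNIV continuous_intros)
    fix x
    let ?e = "cmod (trig_poly N e x)"
    have "2 * ?e * \<tau> \<le> ?e\<^sup>2 + \<tau>\<^sup>2" "0 \<le> ?e\<^sup>2 + \<tau>\<^sup>2" by (auto intro: sum_squares_bound)
    moreover have "(?e + \<tau>) * ?e = ?e\<^sup>2 + ?e * \<tau>" by (simp add: power2_eq_square algebra_simps)
    ultimately have "(?e + \<tau>) * ?e \<le> 2 * ?e\<^sup>2 + \<tau>\<^sup>2" by linarith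
    hence "L * ((?e + \<tau>) * ?e) \<le> L * (2 * ?e\<^sup>2 + \<tau>\<^sup>2)" using L by (rule mult_left_mono)
    thus "L * (?e + \<tau>) * ?e \<le> 2 * L * ?e\<^sup>2 + L * \<tau>\<^sup>2" by (simp add: algebra_simps)
  qed simp
  also have "integral {-pi..pi} (\<lambda>x. 2 * L * (cmod (trig_poly N e x))\<^sup>2 + L * \<tau>\<^sup>2) =
      2 * L * (2 * pi * (\<Sum>j\<in>?I. (cmod (e j))\<^sup>2)) + L * \<tau>\<^sup>2 * (2 * pi)"
    by (subst integral_add) (auto intro!: integrable_on_continuous_UNIV continuous_intros simp: parseval_trig_poly)
  also have "(1 / (2 * pi)) * \<dots> = 2 * L * (\<Sum>j\<in>?I. (cmod (e j))\<^sup>2) + L * \<tau>\<^sup>2"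
    by (simp add: field_simps)
  finally have "Re (\<Sum>j\<in>?I. (- \<i> * of_real (symb s j) * e j + \<i> * fourier_coeff h j) * cnj (e j)) \<le>
     2 * L * (\<Sum>j\<in>?I. (cmod (e j))\<^sup>2) + L * \<tau>\<^sup>2" .
  \<comment> \<open>Doubling the previous bound leaves \<open>2 * L * \<tau>\<^sup>2\<close>; it is
    enlarged to give the form \<open>K * (y + \<delta>)\<close> that the Gronwall argument
    uses.\<close>
  moreover have "L * \<tau>\<^sup>2 \<ge> 0" using L by simp
  ultimately show ?thesis by (simp add: algebra_simps del: Re_sum)
qed

text \<open>\<open>C\<close> is the square of the numerator of the truncation error times the
  Gronwall factor. The condition \<open>3 * C < real N\<close> keeps the resulting bound below the
  threshold at which the error could exceed 1 pointwise.\<close>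

lemma semidiscrete_error:
  fixes K T :: real
  assumes s: "0 < s" "s \<le> 1" and T: "T > 0" and sol: "fnls_solution s T u0 u" and K: "K \<ge> 0"
    and b: "\<And>t j. t \<in> {0..T} \<Longrightarrow> cmod (fourier_coeff (u t) j) \<le> K * weight 10 j"
    and semi: "semidiscrete_solution s N T u0 uN" and N: "N \<ge> 1"
  defines "C \<equiv> (3 * (K + 1))\<^sup>2 * exp (4 * (3 * (3 * K + 1)\<^sup>2) * T)"
  assumes NC: "3 * C < real N" and t: "t \<in> {0..T}"
  shows "(\<Sum>j\<in>{- int N..int N}. (cmod (fourier_coeff (u t) j - fourier_coeff (uN t) j))\<^sup>2) \<le> C / (real N ^ 8)\<^sup>2"
proof -
  let ?I = "{- int N..int N}"
  define c where "c t = fourier_coeff (uN t)" for t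
  note cs = semidiscrete_solution_coeffs[OF semi T, folded c_def]
  define e where "e t j = fourier_coeff (u t) j - c t j" for t j
  define y where "y t = (\<Sum>j\<in>?I. (cmod (e t j))\<^sup>2)" for t
  define h where "h t x = cub (u t x) - cub (uN t x)" for t x
  define e' where "e' t j = - \<i> * of_real (symb s j) * e t j + \<i> * fourier_coeff (h t) j" for t j
  define y' where "y' t = 2 * Re (\<Sum>j\<in>?I. e' t j * cnj (e t j))" for t
  \<comment> \<open>A bound for the tail of \<open>u\<close> beyond frequency \<open>N\<close>;
    \<open>K + 1\<close> instead of \<open>K\<close> makes it strictly positive, as
    \<open>bootstrap_gronwall\<close> requires.\<close>
  define \<tau> where "\<tau> = 3 * (K + 1) / real N ^ 8"
  \<comment> \<open>Lipschitz constant of the cubic term on the ball of radius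
    \<open>3 * K + 1\<close>: \<open>3 * K\<close> bounds \<open>u\<close> and its projection, and 1
    bounds the error during the continuation.\<close>
  define L where "L = 3 * (3 * K + 1)\<^sup>2"
  have cu: "continuous_on UNIV (u t)" if "t \<in> {0..T}" for t using sol that by (auto simp: fnls_solution_def)
  have cuN: "continuous_on UNIV (uN t)" if "t \<in> {0..T}" for t unfolding cs(1)[OF that] by (rule continuous_trig_poly)
  have ch: "continuous_on UNIV (h t)" if "t \<in> {0..T}" for t
    unfolding h_def by (intro continuous_intros cu cuN that)
  have fh: "fourier_coeff (h t) j = fourier_coeff (\<lambda>x. cub (u t x)) j - tri N (c t) (c t) (c t) j"
    if "t \<in> {0..T}" for t j
  proof -
    have "fourier_coeff (h t) j = fourier_coeff (\<lambda>x. cub (u t x) + (-1) * cub (uN t x)) j"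
      by (rule arg_cong[of _ _ "\<lambda>f. fourier_coeff f j"]) (simp add: h_def fun_eq_iff)
    also have "\<dots> = fourier_coeff (\<lambda>x. cub (u t x)) j + (-1) * fourier_coeff (\<lambda>x. cub (uN t x)) j"
    proof -
      have "continuous_on UNIV (\<lambda>x. cub (u t x))" "continuous_on UNIV (\<lambda>x. cub (uN t x))"
        by (intro continuous_intros cu cuN that)+
      thus ?thesis by (simp only: fourier_coeff_add fourier_coeff_mult_left continuous_on_mult continuous_on_const)
    qed
    finally show ?thesis unfolding cs(1)[OF that] fourier_coeff_cub by simp
  qed
  have de: "((\<lambda>\<tau>. e \<tau> j) has_vector_derivative e' t j) (at t within {0..T})" if "t \<in> {0..T}" "j \<in> ?I" for t j
  proof -
    have "((\<lambda>\<tau>. e \<tau> j) has_vector_derivative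
      (- \<i> * of_real (symb s j) * fourier_coeff (u t) j + \<i> * fourier_coeff (\<lambda>x. cub (u t x)) j) - flow s N (c t) j) (at t within {0..T})"
      unfolding e_def by (intro has_vector_derivative_diff fnls_solution_coeffs(2)[OF s sol K b] cs(2) that)
    thus ?thesis unfolding e'_def fh[OF that(1)] flow_def e_def by (simp add: algebra_simps)
  qed
  have dy: "(y has_real_derivative y' t) (at t within {0..T})" if "t \<in> {0..T}" for t
    unfolding y_def y'_def by (rule has_real_derivative_sum_cmod_sq[OF de[OF that]])
  have "y t \<le> \<tau>\<^sup>2 * exp (4 * L * T)"
  \<comment> \<open>By the inverse inequality, energy below \<open>1 / (2 * real N + 1)\<close>
    keeps the modulus of \<open>trig_poly N (e t)\<close> below 1.\<close>
  proof (rule bootstrap_gronwall[where y = y and y' = y' and t = t and \<eta> = "1 / (2 * real N + 1)"])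
    show "continuous_on {0..T} y"
      using dy has_field_derivative_imp_has_derivative has_derivative_continuous
      unfolding continuous_on_eq_continuous_within by blast
    show "y 0 = 0"
    proof -
      have "u 0 = u0" using sol by (simp add: fnls_solution_def)
      thus ?thesis using cs(3) by (simp add: y_def e_def)
    qed
    show "0 < \<tau>\<^sup>2" using K N by (simp add: \<tau>_def)
    show "0 \<le> 4 * L" by (simp add: L_def)
    show "\<tau>\<^sup>2 * exp (4 * L * T) < 1 / (2 * real N + 1)"
    proof -
      have "C * (2 * real N + 1) \<le> C * (3 * real N)" using N by (intro mult_left_mono) (auto simp: C_def)
      also have "\<dots> = 3 * C * real N" by simp
      also have "\<dots> < real N * real N" using NC N by (intro mult_strict_right_mono) auto
      also have "\<dots> \<le> (real N ^ 8)\<^sup>2"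
        using power_increasing[of 2 16 "real N"] N by (simp add: power2_eq_square power_mult[symmetric] power_add[symmetric])
      finally have "C / (real N ^ 8)\<^sup>2 < 1 / (2 * real N + 1)" using N by (simp add: field_simps)
      thus ?thesis by (simp add: C_def \<tau>_def L_def power_divide)
    qed
    show "(y has_real_derivative y' t) (at t)" if "0 < t" "t < T" for t
      using dy[of t] that by (simp add: at_within_Icc_at)
    show "t \<in> {0..T}" by fact
    fix t assume t: "0 < t" "t < T" and small: "y t < 1 / (2 * real N + 1)"
    hence tT: "t \<in> {0..T}" by simp
    have hb: "cmod (h t x) \<le> L * (cmod (trig_poly N (e t) x) + \<tau>)" for x
    proof -
      let ?p = "trig_poly N (fourier_coeff (u t)) x"
      have "(cmod (trig_poly N (e t) x))\<^sup>2 \<le> (2 * real N + 1) * y t"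
        unfolding y_def by (rule norm_trig_poly_sq_le)
      also have "\<dots> \<le> 1\<^sup>2" using small by (simp add: field_simps)
      finally have e1: "cmod (trig_poly N (e t) x) \<le> 1" by (rule power2_le_imp_le) simp
      have sm: "(\<lambda>j. cmod (fourier_coeff (u t) j)) summable_on UNIV"
        by (rule abs_summable_weight[OF b[OF tT]]) simp
      have ux: "u t x = fourier_series (fourier_coeff (u t)) x"
        using fnls_solution_coeffs(1)[OF s sol K b tT] by metis
      have u1: "cmod (u t x) \<le> 3 * K"
        unfolding ux by (rule order_trans[OF norm_fourier_series_le[OF sm] infsum_norm_weight_le[OF b[OF tT] _ K]]) simp
      have p1: "cmod ?p \<le> 3 * K"
        using norm_trig_poly_le[of N "fourier_coeff (u t)" x] sum_weight_bounded_le[of N 10 K "fourier_coeff (u t)"] K b[OF tT]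
        by (auto simp: weight_bounded_def)
      have ed: "trig_poly N (e t) x = ?p - uN t x"
        unfolding cs(1)[OF tT] by (simp add: trig_poly_diff e_def[abs_def])
      have "cmod (uN t x) \<le> 3 * K + 1"
        using norm_triangle_ineq4[of ?p "trig_poly N (e t) x"] p1 e1 by (simp add: ed)
      hence "cmod (h t x) \<le> 3 * (3 * K + 1)\<^sup>2 * cmod (u t x - uN t x)"
        unfolding h_def using u1 by (intro cub_diff_le) auto
      also have "\<dots> \<le> L * (cmod (trig_poly N (e t) x) + \<tau>)"
        unfolding L_def
      \<comment> \<open>\<open>u - uN\<close> is the sum of \<open>trig_poly N (e t)\<close> and the
        part of \<open>u\<close> removed by the projection.\<close>
      proof (rule mult_left_mono)
        have "cmod (u t x - ?p) \<le> 3 * (K / real N ^ 8)"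
          unfolding ux by (rule fourier_series_tail[OF b[OF tT] K N])
        also have "\<dots> \<le> \<tau>" by (simp add: \<tau>_def divide_right_mono)
        finally show "cmod (u t x - uN t x) \<le> cmod (trig_poly N (e t) x) + \<tau>"
          using norm_triangle_ineq[of "trig_poly N (e t) x" "u t x - ?p"] by (simp add: ed)
      qed simp
      finally show ?thesis .
    qed
    show "y' t \<le> 4 * L * (y t + \<tau>\<^sup>2)"
      unfolding y'_def y_def e'_def
      by (rule energy_production_le[OF ch[OF tT] hb]) (simp add: L_def)
  qed
  also have "\<dots> = C / (real N ^ 8)\<^sup>2" by (simp add: C_def \<tau>_def L_def power_divide)
  finally show ?thesis by (simp add: y_def e_def c_def)
qed

lemma semidiscrete_regularity:
  fixes K T :: real
  assumes s: "0 < s" "s \<le> 1" and T: "T > 0" and sol: "fnls_solution s T u0 u" and K: "K \<ge> 0"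
    and b: "\<And>t j. t \<in> {0..T} \<Longrightarrow> cmod (fourier_coeff (u t) j) \<le> K * weight 10 j"
  shows "\<exists>K'\<ge>0. \<forall>N uN. 1 \<le> N \<longrightarrow> semidiscrete_solution s N T u0 uN \<longrightarrow>
     (\<forall>t\<in>{0..T}. weight_bounded N 8 K' (fourier_coeff (uN t)))"
proof -
  define C where "C = (3 * (K + 1))\<^sup>2 * exp (4 * (3 * (3 * K + 1)\<^sup>2) * T)"
  have C: "C \<ge> 0" by (simp add: C_def)
  \<comment> \<open>The first summand serves the large \<open>N\<close>, where \<open>uN\<close> is
    compared with \<open>u\<close>; the second serves the \<open>N\<close> with
    \<open>N \<le> 3 * C\<close>.\<close>
  define K' where "K' = (K + 2 ^ 8 * sqrt C) + 2 * K * (1 + 3 * C) ^ 8"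
  show ?thesis
  proof (intro exI[of _ K'] conjI allI impI ballI)
    show "K' \<ge> 0" using K C by (simp add: K'_def)
    fix N uN t
    assume N: "1 \<le> N" and semi: "semidiscrete_solution s N T u0 uN" and t: "t \<in> {0..T}"
    let ?I = "{- int N..int N}"
    define c where "c t = fourier_coeff (uN t)" for t
    note cs = semidiscrete_solution_coeffs[OF semi T, folded c_def]
    show "weight_bounded N 8 K' (fourier_coeff (uN t))"
      unfolding weight_bounded_def
    proof
      fix j assume j: "j \<in> ?I"
      have w0: "weight 8 j \<ge> 0" by simp
      show "cmod (fourier_coeff (uN t) j) \<le> K' * weight 8 j"
      proof (cases "3 * C < real N")
        case True
        have "(cmod (fourier_coeff (u t) j - c t j))\<^sup>2 \<le> (\<Sum>j\<in>?I. (cmod (fourier_coeff (u t) j - c t j))\<^sup>2)"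
          by (rule member_le_sum) (use j in auto)
        also have "\<dots> \<le> C / (real N ^ 8)\<^sup>2"
          unfolding c_def C_def using True t by (intro semidiscrete_error[OF s T sol K b semi N]) (auto simp: C_def)
        also have "\<dots> = (sqrt C / real N ^ 8)\<^sup>2" using C by (simp add: power_divide)
        finally have "cmod (fourier_coeff (u t) j - c t j) \<le> sqrt C / real N ^ 8"
          using C by (auto dest: power2_le_imp_le)
        also have "\<dots> = sqrt C * (1 / real N ^ 8)" by simp
        also have "\<dots> \<le> sqrt C * (2 ^ 8 * weight 8 j)"
        proof (intro mult_left_mono)
          \<comment> \<open>For the frequencies present, \<open>1 + |j|\<close> is at most
            \<open>2 * N\<close>, so a uniform bound of order \<open>N^(-8)\<close> is also a
            weighted one.\<close>
          have "(1 + \<bar>real_of_int j\<bar>) ^ 8 \<le> (2 * real N) ^ 8" using j N by (intro power_mono) auto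
          thus "1 / real N ^ 8 \<le> 2 ^ 8 * weight 8 j"
            using N by (simp add: weight_def power_mult_distrib field_simps add_pos_nonneg)
        qed (use C in simp)
        finally have e: "cmod (fourier_coeff (u t) j - c t j) \<le> 2 ^ 8 * sqrt C * weight 8 j" by simp
        have "cmod (fourier_coeff (u t) j) \<le> K * weight 8 j"
          using b[OF t, of j] mult_left_mono[OF weight_antimono[of 8 10 j] K] by simp
        hence "cmod (c t j) \<le> K * weight 8 j + 2 ^ 8 * sqrt C * weight 8 j"
          using e norm_triangle_ineq4[of "fourier_coeff (u t) j" "fourier_coeff (u t) j - c t j"] by simp
        also have "\<dots> = (K + 2 ^ 8 * sqrt C) * weight 8 j" by (simp add: distrib_right)
        also have "\<dots> \<le> K' * weight 8 j"
          unfolding K'_def using K C by (intro mult_right_mono w0) simp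
        finally show ?thesis by (simp add: c_def)
      next
        case False
        have "(cmod (c t j))\<^sup>2 \<le> (\<Sum>j\<in>?I. (cmod (c t j))\<^sup>2)"
          by (rule member_le_sum) (use j in auto)
        also have "\<dots> = (\<Sum>j\<in>?I. (cmod (c 0 j))\<^sup>2)" by (rule flow_mass_conserved[OF cs(2) t])
        also have "\<dots> \<le> 3 * K\<^sup>2"
        proof (rule sum_weight_bounded_sq_le[of N 10])
          have "u 0 = u0" using sol by (simp add: fnls_solution_def)
          thus "weight_bounded N 10 K (c 0)"
            using b[of 0] T cs(3) by (auto simp: weight_bounded_def)
        qed simp
        also have "\<dots> \<le> (2 * K)\<^sup>2" by (simp add: power_mult_distrib)
        finally have "cmod (c t j) \<le> 2 * K" by (rule power2_le_imp_le) (use K in simp)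
        also have "\<dots> = 2 * K * 1" by simp
        also have "\<dots> \<le> 2 * K * ((1 + 3 * C) ^ 8 * weight 8 j)"
        proof (rule mult_left_mono)
          \<comment> \<open>Here \<open>|j|\<close> is at most \<open>3 * C\<close>, so the weight
            is bounded below and conservation of mass suffices.\<close>
          have "\<bar>real_of_int j\<bar> \<le> real N" using j by auto
          hence "(1 + \<bar>real_of_int j\<bar>) ^ 8 \<le> (1 + 3 * C) ^ 8" using False by (intro power_mono) auto
          thus "1 \<le> (1 + 3 * C) ^ 8 * weight 8 j" by (simp add: weight_def le_divide_eq add_pos_nonneg)
        qed (use K in simp)
        also have "\<dots> = (2 * K * (1 + 3 * C) ^ 8) * weight 8 j" by simp
        also have "\<dots> \<le> K' * weight 8 j"
          unfolding K'_def using K C by (intro mult_right_mono w0) simp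
        finally show ?thesis by (simp add: c_def)
      qed
    qed
  qed
qed

section \<open>Local error of the midpoint rule\<close>

lemma cub_eq: "cub z = z * z * cnj z"
  by (simp only: complex_norm_square) simp

text \<open>The terms odd in \<open>d\<close> cancel. With \<open>a\<close> the average and
  \<open>d\<close> half the increment over a step, the trapezoidal and the midpoint value of the
  cubic term differ by a quantity quadratic in the increment.\<close>

lemma cub_average:
  "(cub (a - d) + cub (a + d)) / 2 = cub a + (d * d * cnj a + 2 * a * (d * cnj d))"
  unfolding cub_eq complex_cnj_add complex_cnj_diff by (simp add: field_simps)

lemma trig_poly_half: "trig_poly N (\<lambda>j. a j / 2) x = trig_poly N a x / 2"
  by (simp add: trig_poly_def sum_divide_distrib)

text \<open>The difference of the squared moduli is \<open>2 * Re ((z j - v j) * cnj (b j))\<close>,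
  and \<open>z j - v j\<close> is \<open>k\<close> times the flow at the midpoint \<open>b\<close>,
  so \<open>Re_flow_zero\<close> applies.\<close>

lemma midpoint_mass_conserved:
  assumes "\<And>j. j \<in> {- int N..int N} \<Longrightarrow> z j = v j + of_real k * flow s N (\<lambda>j. (z j + v j) / 2) j"
  shows "(\<Sum>j\<in>{- int N..int N}. (cmod (z j))\<^sup>2) = (\<Sum>j\<in>{- int N..int N}. (cmod (v j))\<^sup>2)"
proof -
  let ?I = "{- int N..int N}"
  define b where "b j = (z j + v j) / 2" for j
  have "(\<Sum>j\<in>?I. (cmod (z j))\<^sup>2) - (\<Sum>j\<in>?I. (cmod (v j))\<^sup>2) = (\<Sum>j\<in>?I. 2 * Re ((z j - v j) * cnj (b j)))"
    unfolding sum_subtractf[symmetric]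
    by (intro sum.cong refl) (simp add: b_def cmod_power2, simp add: power2_eq_square field_simps)
  also have "\<dots> = (\<Sum>j\<in>?I. 2 * Re (of_real k * (flow s N b j * cnj (b j))))"
    by (intro sum.cong refl) (simp add: assms b_def[symmetric] mult.assoc)
  also have "\<dots> = 2 * k * Re (\<Sum>j\<in>?I. flow s N b j * cnj (b j))"
    unfolding Re_sum sum_distrib_left by (intro sum.cong refl) (simp add: algebra_simps)
  also have "\<dots> = 0" by (simp only: Re_flow_zero mult_zero_right)
  finally show ?thesis by simp
qed

text \<open>By convexity the average has mass at most \<open>m\<close>. The factor
  \<open>2 N + 1\<close> of the inverse inequality is then rounded up to \<open>3 N\<close>, using
  \<open>N \<ge> 1\<close>.\<close>

lemma norm_average_trig_poly_sq_le:
  assumes "N \<ge> 1" "(\<Sum>j\<in>{- int N..int N}. (cmod (a j))\<^sup>2) = m" "(\<Sum>j\<in>{- int N..int N}. (cmod (b j))\<^sup>2) = m"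
  shows "(cmod (trig_poly N (\<lambda>j. (a j + b j) / 2) x))\<^sup>2 \<le> 3 * real N * m"
proof -
  let ?I = "{- int N..int N}"
  have m: "m \<ge> 0" unfolding assms(2)[symmetric] by (intro sum_nonneg) auto
  have "(\<Sum>j\<in>?I. (cmod ((a j + b j) / 2))\<^sup>2) \<le> (\<Sum>j\<in>?I. ((cmod (a j))\<^sup>2 + (cmod (b j))\<^sup>2) / 2)"
  proof (intro sum_mono)
    fix j
    have "cmod ((a j + b j) / 2) \<le> (cmod (a j) + cmod (b j)) / 2"
      using norm_triangle_ineq[of "a j" "b j"] by (simp add: norm_divide)
    hence "(cmod ((a j + b j) / 2))\<^sup>2 \<le> ((cmod (a j) + cmod (b j)) / 2)\<^sup>2" by (intro power_mono) auto
    also have "\<dots> \<le> ((cmod (a j))\<^sup>2 + (cmod (b j))\<^sup>2) / 2"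
      using sum_squares_bound[of "cmod (a j)" "cmod (b j)"] by (simp add: power2_eq_square field_simps)
    finally show "(cmod ((a j + b j) / 2))\<^sup>2 \<le> ((cmod (a j))\<^sup>2 + (cmod (b j))\<^sup>2) / 2" .
  qed
  also have "\<dots> = m" by (simp add: sum_divide_distrib[symmetric] sum.distrib assms)
  finally have le: "(\<Sum>j\<in>?I. (cmod ((a j + b j) / 2))\<^sup>2) \<le> m" .
  have "(cmod (trig_poly N (\<lambda>j. (a j + b j) / 2) x))\<^sup>2 \<le> (2 * real N + 1) * m"
    by (rule order_trans[OF norm_trig_poly_sq_le mult_left_mono[OF le]]) simp
  also have "\<dots> \<le> 3 * real N * m" using assms(1) m by (intro mult_right_mono) auto
  finally show ?thesis .
qed

text \<open>\<open>w\<close> is the exact value after one step and \<open>\<rho>\<close> its defect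
  in the trapezoidal rule. Since \<open>m\<close> is a sum over coefficients,
  \<open>2 * pi * m\<close> is the squared L2 norm.\<close>

lemma midpoint_local_error:
  fixes v w z \<rho> :: "int \<Rightarrow> complex" and K L G k m :: real
  assumes N: "N \<ge> 1" and k: "k > 0" and K: "K \<ge> 0" and L: "L \<ge> 0"
    and w: "\<And>j. j \<in> {- int N..int N} \<Longrightarrow> w j = v j + of_real (k / 2) * (flow s N v j + flow s N w j) + \<rho> j"
    and z: "\<And>j. j \<in> {- int N..int N} \<Longrightarrow> z j = v j + of_real k * flow s N (\<lambda>j. (z j + v j) / 2) j"
    and mv: "(\<Sum>j\<in>{- int N..int N}. (cmod (v j))\<^sup>2) = m" and mw: "(\<Sum>j\<in>{- int N..int N}. (cmod (w j))\<^sup>2) = m"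
    and cfl: "3 * (2 * pi * m) * k * real N < 1"
    and bv: "weight_bounded N 8 K v" and bw: "weight_bounded N 8 K w"
    and bd: "weight_bounded N 6 (L * k) (\<lambda>j. w j - v j)"
    and b\<rho>: "weight_bounded N 2 (G * k ^ 3) \<rho>"
  shows "(\<Sum>j\<in>{- int N..int N}. (cmod (w j - z j))\<^sup>2) \<le> 4 * ((81 / 4 * K * L\<^sup>2)\<^sup>2 + 3 * G\<^sup>2) * k ^ 6"
proof -
  let ?I = "{- int N..int N}"
  define e where "e j = w j - z j" for j
  define b where "b j = (z j + v j) / 2" for j
  define S where "S = (\<Sum>j\<in>?I. (cmod (e j))\<^sup>2)"
  \<comment> \<open>From \<open>3 * (cmod (A x) * (cmod (D x))\<^sup>2)\<close> with the bounds
    \<open>3 * K\<close> and \<open>3 / 2 * (L * k)\<close>.\<close>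
  define Q where "Q = 81 / 4 * K * L\<^sup>2"
  define V where "V = trig_poly N v"
  define W where "W = trig_poly N w"
  define A where "A = trig_poly N (\<lambda>j. (w j + v j) / 2)"
  define B where "B = trig_poly N b"
  define D where "D = trig_poly N (\<lambda>j. (w j - v j) / 2)"
  \<comment> \<open>Trapezoidal minus midpoint value of the cubic term. The linear terms leave only
    half the symbol acting on \<open>e\<close>, which drops out of the pairing.\<close>
  define H where "H x = (1/2) * (cub (V x) + cub (W x)) + (-1) * cub (B x)" for x
  have m: "m \<ge> 0" unfolding mv[symmetric] by (intro sum_nonneg) auto
  have cont: "continuous_on UNIV V" "continuous_on UNIV W" "continuous_on UNIV B"
    unfolding V_def W_def B_def by (intro continuous_trig_poly)+
  have contc: "continuous_on UNIV (\<lambda>x. cub (V x))" "continuous_on UNIV (\<lambda>x. cub (W x))" "continuous_on UNIV (\<lambda>x. cub (B x))"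
    by (intro continuous_intros cont)+
  have cH: "continuous_on UNIV H"
    unfolding H_def by (intro continuous_intros cont)
  have fH: "fourier_coeff H j = (tri N v v v j + tri N w w w j) / 2 - tri N b b b j" for j
  proof -
    have "fourier_coeff H j = (1/2) * (fourier_coeff (\<lambda>x. cub (V x)) j + fourier_coeff (\<lambda>x. cub (W x)) j)
       + (-1) * fourier_coeff (\<lambda>x. cub (B x)) j"
      unfolding H_def using contc
      by (simp only: fourier_coeff_add fourier_coeff_mult_left continuous_on_mult continuous_on_const continuous_on_add)
    thus ?thesis unfolding V_def W_def B_def fourier_coeff_cub by simp
  qed
  have ej: "e j = of_real (k / 2) * (- \<i> * of_real (symb s j) * e j) + of_real k * (\<i> * fourier_coeff H j) + \<rho> j"
    if j: "j \<in> ?I" for j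
  proof -
    have "e j = of_real (k / 2) * (flow s N v j + flow s N w j) + \<rho> j - of_real k * flow s N b j"
      unfolding e_def b_def[abs_def] using w[OF j] z[OF j] by (metis (no_types, lifting) add.assoc add_diff_cancel_left)
    also have "\<dots> = of_real (k / 2) * (- \<i> * of_real (symb s j) * e j) + of_real k * (\<i> * fourier_coeff H j) + \<rho> j"
      unfolding flow_def fH by (simp add: b_def e_def field_simps)
    finally show ?thesis .
  qed
  have AD: "V x = A x - D x" "W x = A x + D x" "A x - B x = trig_poly N e x / 2" for x
    unfolding V_def W_def A_def B_def D_def b_def[abs_def] e_def[abs_def] trig_poly_half
      trig_poly_add[symmetric] trig_poly_diff[symmetric]
    by (simp_all add: field_simps)
  have mz: "(\<Sum>j\<in>?I. (cmod (z j))\<^sup>2) = m"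
    unfolding mv[symmetric] by (rule midpoint_mass_conserved[OF z])
  have bA: "cmod (A x) \<le> sqrt (3 * real N * m)" and bB: "cmod (B x) \<le> sqrt (3 * real N * m)" for x
    unfolding A_def B_def b_def[abs_def]
    by (intro real_le_rsqrt norm_average_trig_poly_sq_le N mv mw mz)+
  have bH: "cmod (H x) \<le> (9 / 2 * (real N * m)) * cmod (trig_poly N e x) + Q * k\<^sup>2" for x
  proof -
    have V3: "cmod (V x) \<le> 3 * K" and W3: "cmod (W x) \<le> 3 * K"
      unfolding V_def W_def
      by (rule order_trans[OF norm_trig_poly_le sum_weight_bounded_le[OF bv _ K]], simp,
          rule order_trans[OF norm_trig_poly_le sum_weight_bounded_le[OF bw _ K]], simp)
    have "2 * A x = V x + W x" by (simp add: AD)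
    hence "2 * cmod (A x) = cmod (V x + W x)" using norm_mult[of 2 "A x"] by simp
    hence A3: "cmod (A x) \<le> 3 * K" using norm_triangle_ineq[of "V x" "W x"] V3 W3 by linarith
    have "cmod (2 * D x) \<le> 3 * (L * k)"
      using order_trans[OF norm_trig_poly_le sum_weight_bounded_le[OF bd], of x] L k
      by (simp add: D_def trig_poly_half)
    hence D3: "cmod (D x) \<le> 3 / 2 * (L * k)" by (simp add: norm_mult)
    have "H x = (cub (A x) - cub (B x)) + (D x * D x * cnj (A x) + 2 * A x * (D x * cnj (D x)))"
      using cub_average[of "A x" "D x"] unfolding H_def AD by (simp add: algebra_simps)
    hence "cmod (H x) \<le> cmod (cub (A x) - cub (B x)) + cmod (D x * D x * cnj (A x) + 2 * A x * (D x * cnj (D x)))"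
      using norm_triangle_ineq by metis
    also have "cmod (D x * D x * cnj (A x) + 2 * A x * (D x * cnj (D x))) \<le> 3 * (cmod (A x) * (cmod (D x))\<^sup>2)"
      by (rule norm_triangle_le) (simp add: norm_mult power2_eq_square mult_ac)
    also have "\<dots> \<le> 3 * (3 * K * (3 / 2 * (L * k))\<^sup>2)"
      by (intro mult_left_mono mult_mono power_mono A3 D3) (use K in auto)
    also have "\<dots> = Q * k\<^sup>2" by (simp add: Q_def power_mult_distrib power2_eq_square)
    also have "cmod (cub (A x) - cub (B x)) \<le> 3 * (sqrt (3 * real N * m))\<^sup>2 * cmod (A x - B x)"
      by (rule cub_diff_le[OF bA bB])
    also have "\<dots> = (9 / 2 * (real N * m)) * cmod (trig_poly N e x)"
      using m by (simp add: AD norm_divide)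
    finally show ?thesis by simp
  qed
  \<comment> \<open>The Lipschitz factor is \<open>3 * (3 * N * m)\<close> times the 1/2 from
    \<open>A - B\<close>. The step size restriction bounds \<open>6 * pi * k * N * m\<close> by 1,
    and \<open>pi > 3\<close> gives the room to reach 1/4.\<close>
  have kN: "k * (9 / 2 * (real N * m)) \<le> 1 / 4"
  proof -
    have "k * (real N * m) * 18 \<le> k * (real N * m) * (6 * pi)"
      by (intro mult_left_mono) (use k m pi_gt3 in auto)
    also have "\<dots> = 3 * (2 * pi * m) * k * real N" by simp
    also have "\<dots> < 1" by (rule cfl)
    finally show ?thesis by (simp add: mult_ac)
  qed
  \<comment> \<open>A share 1/2 of the error comes from the cubic term and 1/4 from the defect; the
    remaining quarter is the source of the factor 4.\<close>
  have absorb: "y \<le> 4 * (p + q)" if "y \<le> y / 2 + p + (q + y / 4)" for y p q :: real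
    using that by simp
  have Re_scale: "Re (of_real r * x) = r * Re x" for r x by simp
  have "S = Re (\<Sum>j\<in>?I. e j * cnj (e j))"
    unfolding S_def Re_sum by (rule sum.cong) (simp_all add: complex_norm_square[symmetric] del: of_real_power)
  also have "(\<Sum>j\<in>?I. e j * cnj (e j)) = (\<Sum>j\<in>?I. of_real (k / 2) * (- \<i> * of_real (symb s j) * e j * cnj (e j))
      + of_real k * (\<i> * (fourier_coeff H j * cnj (e j))) + \<rho> j * cnj (e j))"
  proof (rule sum.cong[OF refl])
    fix j assume "j \<in> ?I"
    from arg_cong[OF ej[OF this], of "\<lambda>t. t * cnj (e j)"]
    show "e j * cnj (e j) = of_real (k / 2) * (- \<i> * of_real (symb s j) * e j * cnj (e j))
      + of_real k * (\<i> * (fourier_coeff H j * cnj (e j))) + \<rho> j * cnj (e j)"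
      by (simp only: distrib_right mult.assoc)
  qed
  also have "Re \<dots> = k / 2 * Re (\<Sum>j\<in>?I. - \<i> * of_real (symb s j) * e j * cnj (e j))
      + k * Re (\<i> * (\<Sum>j\<in>?I. fourier_coeff H j * cnj (e j))) + Re (\<Sum>j\<in>?I. \<rho> j * cnj (e j))"
    unfolding sum.distrib sum_distrib_left[symmetric] by (simp only: plus_complex.simps Re_scale)
  also have "\<dots> = k * Re (\<i> * (\<Sum>j\<in>?I. fourier_coeff H j * cnj (e j))) + Re (\<Sum>j\<in>?I. \<rho> j * cnj (e j))"
    by (simp only: Re_dispersion_zero mult_zero_right add_0)
  also have "\<dots> \<le> (S / 2 + Q\<^sup>2 * k ^ 6) + (3 * (G * k ^ 3)\<^sup>2 + S / 4)"
  proof (rule add_mono)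
    have "Re (\<i> * (\<Sum>j\<in>?I. fourier_coeff H j * cnj (e j))) \<le> cmod (\<Sum>j\<in>?I. fourier_coeff H j * cnj (e j))"
      using complex_Re_le_cmod[of "\<i> * (\<Sum>j\<in>?I. fourier_coeff H j * cnj (e j))"] by (simp only: norm_mult norm_ii mult_1)
    also have "\<dots> \<le> (1 / (2 * pi)) * integral {-pi..pi} (\<lambda>x.
        ((9 / 2 * (real N * m)) * cmod (trig_poly N e x) + Q * k\<^sup>2) * cmod (trig_poly N e x))"
      by (rule norm_fourier_coeff_pairing_le[OF cH bH]) (intro continuous_intros)
    finally have "k * Re (\<i> * (\<Sum>j\<in>?I. fourier_coeff H j * cnj (e j))) \<le>
       k * ((1 / (2 * pi)) * integral {-pi..pi} (\<lambda>x.
        ((9 / 2 * (real N * m)) * cmod (trig_poly N e x) + Q * k\<^sup>2) * cmod (trig_poly N e x)))"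
      by (rule mult_left_mono) (use k in simp)
    also have "\<dots> = (1 / (2 * pi)) * integral {-pi..pi} (\<lambda>x. k *
        (((9 / 2 * (real N * m)) * cmod (trig_poly N e x) + Q * k\<^sup>2) * cmod (trig_poly N e x)))"
      by simp
    \<comment> \<open>One quarter of the squared error comes from \<open>kN\<close>, another from
      Young's inequality applied to the product with \<open>Q * k ^ 3\<close>.\<close>
    also have "\<dots> \<le> (1 / (2 * pi)) * integral {-pi..pi} (\<lambda>x. 1 / 2 * (cmod (trig_poly N e x))\<^sup>2 + (Q * k ^ 3)\<^sup>2)"
    proof (intro mult_left_mono integral_le integrable_on_continuous_UNIV continuous_intros)
      fix x
      let ?e = "cmod (trig_poly N e x)"
      have "k * (9 / 2 * (real N * m)) * ?e\<^sup>2 \<le> 1 / 4 * ?e\<^sup>2" by (rule mult_right_mono[OF kN]) simp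
      moreover have "2 * (?e / 2) * (Q * k ^ 3) \<le> (?e / 2)\<^sup>2 + (Q * k ^ 3)\<^sup>2" by (rule sum_squares_bound)
      moreover have "(?e / 2)\<^sup>2 = 1 / 4 * ?e\<^sup>2" by (simp add: power_divide)
      moreover have "k * (((9 / 2 * (real N * m)) * ?e + Q * k\<^sup>2) * ?e) =
         k * (9 / 2 * (real N * m)) * ?e\<^sup>2 + 2 * (?e / 2) * (Q * k ^ 3)"
        by (simp add: power2_eq_square power3_eq_cube algebra_simps)
      ultimately show "k * (((9 / 2 * (real N * m)) * ?e + Q * k\<^sup>2) * ?e) \<le> 1 / 2 * ?e\<^sup>2 + (Q * k ^ 3)\<^sup>2"
        by linarith
    qed simp
    also have "integral {-pi..pi} (\<lambda>x. 1 / 2 * (cmod (trig_poly N e x))\<^sup>2 + (Q * k ^ 3)\<^sup>2) =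
        1 / 2 * (2 * pi * S) + (Q * k ^ 3)\<^sup>2 * (2 * pi)"
      unfolding S_def parseval_trig_poly[symmetric]
      by (subst integral_add) (auto intro!: integrable_on_continuous_UNIV continuous_intros)
    also have "(1 / (2 * pi)) * \<dots> = S / 2 + Q\<^sup>2 * k ^ 6"
      by (simp add: field_simps power_mult_distrib power_mult[symmetric])
    finally show "k * Re (\<i> * (\<Sum>j\<in>?I. fourier_coeff H j * cnj (e j))) \<le> S / 2 + Q\<^sup>2 * k ^ 6" .
    have "Re (\<Sum>j\<in>?I. \<rho> j * cnj (e j)) \<le> cmod (\<Sum>j\<in>?I. \<rho> j * cnj (e j))" by (rule complex_Re_le_cmod)
    also have "\<dots> \<le> (\<Sum>j\<in>?I. (cmod (\<rho> j))\<^sup>2 + 1 / 4 * (cmod (e j))\<^sup>2)"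
    proof (rule sum_norm_le)
      fix j
      show "cmod (\<rho> j * cnj (e j)) \<le> (cmod (\<rho> j))\<^sup>2 + 1 / 4 * (cmod (e j))\<^sup>2"
        using sum_squares_bound[of "cmod (\<rho> j)" "cmod (e j) / 2"] by (simp add: norm_mult power_divide)
    qed
    also have "\<dots> = (\<Sum>j\<in>?I. (cmod (\<rho> j))\<^sup>2) + S / 4"
      by (simp add: sum.distrib S_def sum_divide_distrib)
    also have "\<dots> \<le> 3 * (G * k ^ 3)\<^sup>2 + S / 4"
      by (intro add_right_mono sum_weight_bounded_sq_le[OF b\<rho>]) simp
    finally show "Re (\<Sum>j\<in>?I. \<rho> j * cnj (e j)) \<le> 3 * (G * k ^ 3)\<^sup>2 + S / 4" .
  qed
  finally have "S \<le> 4 * (Q\<^sup>2 * k ^ 6 + 3 * (G * k ^ 3)\<^sup>2)" by (rule absorb)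
  also have "\<dots> = 4 * (Q\<^sup>2 + 3 * G\<^sup>2) * k ^ 6"
    by (simp add: power_mult_distrib power_mult[symmetric] algebra_simps)
  finally show ?thesis by (simp add: S_def e_def Q_def)
qed

section \<open>From a midpoint step to the uniform bound\<close>

lemma midpoint_step_coeffs:
  assumes "midpoint_step s N k (trig_poly N v) z"
  obtains z' where "z = trig_poly N z'"
    "\<And>j. j \<in> {- int N..int N} \<Longrightarrow> z' j = v j + of_real k * flow s N (\<lambda>j. (z' j + v j) / 2) j"
proof -
  obtain z' where z: "z = trig_poly N z'" using assms by (auto simp: midpoint_step_def trig_polys_iff)
  have avg: "(\<lambda>y. (z y + trig_poly N v y) / 2) = trig_poly N (\<lambda>j. (z' j + v j) / 2)"
    by (rule ext) (simp add: z trig_poly_def sum.distrib[symmetric] sum_divide_distrib distrib_right add_divide_distrib)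
  have "trig_poly N z' x = trig_poly N (\<lambda>j. v j + of_real k * flow s N (\<lambda>j. (z' j + v j) / 2) j) x" for x
    using assms unfolding midpoint_step_def avg semidiscrete_rhs_flow trig_poly_mult trig_poly_add by (simp add: z)
  from trig_poly_inject[OF this] that[OF z] show thesis by blast
qed

theorem propositionA1:
  fixes s :: real
  assumes "0 < s" and "s \<le> 1"
  shows "\<exists>\<mu>0::real. \<forall>\<mu>\<ge>\<mu>0. \<forall>(T::real) (u0 :: real \<Rightarrow> complex) (u :: real \<Rightarrow> real \<Rightarrow> complex).
    0 < T \<longrightarrow> smooth u0 \<longrightarrow> periodic_2pi u0 \<longrightarrow>
    fnls_solution s T u0 u \<longrightarrow>
    (\<exists>B. \<forall>t\<in>{0..T}. u t \<in> sobolev_space \<mu> \<and> sobolev_norm \<mu> (u t) \<le> B) \<longrightarrow>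
    (\<exists>C::real. \<forall>(N::nat) (M::nat) (k::real)
        (uN :: real \<Rightarrow> real \<Rightarrow> complex) (Z :: nat \<Rightarrow> real \<Rightarrow> complex).
      1 \<le> N \<longrightarrow> 0 < k \<longrightarrow> T = real M * k \<longrightarrow>
      3 * (L2norm (fourier_proj N u0))\<^sup>2 * k * real N < 1 \<longrightarrow>
      semidiscrete_solution s N T u0 uN \<longrightarrow>
      (\<forall>n<M. midpoint_step s N k (uN (real n * k)) (Z n)) \<longrightarrow>
      (MAX n\<in>{..<M}. L2norm (\<lambda>x. uN (real (Suc n) * k) x - Z n x)) \<le> C * k ^ 3)"
proof (rule exI[of _ "10::real"], intro allI impI, elim exE)
  fix \<mu> T B :: real and u0 :: "real \<Rightarrow> complex" and u :: "real \<Rightarrow> real \<Rightarrow> complex"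
  assume \<mu>: "10 \<le> \<mu>" and T: "0 < T" and sol: "fnls_solution s T u0 u"
    and B: "\<forall>t\<in>{0..T}. u t \<in> sobolev_space \<mu> \<and> sobolev_norm \<mu> (u t) \<le> B"
  \<comment> \<open>The threshold 10 for \<open>\<mu>\<close> gives \<open>u\<close> ten orders of
    decay, of which eight pass to \<open>uN\<close>; three time derivatives use six of these and
    leave the two required for summation.\<close>
  define K0 where "K0 = 2 ^ 10 * \<bar>B\<bar>"
  have K0: "K0 \<ge> 0" by (simp add: K0_def)
  have b: "cmod (fourier_coeff (u t) j) \<le> K0 * weight 10 j" if "t \<in> {0..T}" for t j
    unfolding K0_def using bspec[OF B that] \<mu> by (intro sobolev_coeff_le[where \<mu> = \<mu>]) auto
  obtain K where K: "K \<ge> 0" and reg: "\<And>N uN t. 1 \<le> N \<Longrightarrow> semidiscrete_solution s N T u0 uN \<Longrightarrow>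
     t \<in> {0..T} \<Longrightarrow> weight_bounded N 8 K (fourier_coeff (uN t))"
    using semidiscrete_regularity[OF assms T sol K0 b] by blast
  obtain L where L: "L \<ge> 0" and der: "\<And>N T c.
     \<forall>t\<in>{0..T}. \<forall>j\<in>{- int N..int N}.
        ((\<lambda>\<tau>. c \<tau> j) has_vector_derivative flow s N (c t) j) (at t within {0..T}) \<Longrightarrow>
     \<forall>t\<in>{0..T}. weight_bounded N 8 K (c t) \<Longrightarrow>
     \<exists>c2 c3. \<forall>t\<in>{0..T}.
        (\<forall>j\<in>{- int N..int N}.
          ((\<lambda>\<tau>. flow s N (c \<tau>) j) has_vector_derivative c2 t j) (at t within {0..T}) \<and>
          ((\<lambda>\<tau>. c2 \<tau> j) has_vector_derivative c3 t j) (at t within {0..T})) \<and>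
        weight_bounded N 6 L (flow s N (c t)) \<and> weight_bounded N 2 L (c3 t)"
    using flow_time_derivatives[OF assms K] by blast
  \<comment> \<open>\<open>2 * pi\<close> is the Parseval factor, and \<open>L / 2\<close> the
    constant of the trapezoidal remainder. \<open>C\<close> is fixed before \<open>N\<close>,
    \<open>M\<close>, \<open>k\<close>, \<open>uN\<close> and \<open>Z\<close>.\<close>
  define C where "C = sqrt (2 * pi * (4 * ((81 / 4 * K * L\<^sup>2)\<^sup>2 + 3 * (L / 2)\<^sup>2)))"
  show "\<exists>C::real. \<forall>(N::nat) (M::nat) (k::real)
        (uN :: real \<Rightarrow> real \<Rightarrow> complex) (Z :: nat \<Rightarrow> real \<Rightarrow> complex).
      1 \<le> N \<longrightarrow> 0 < k \<longrightarrow> T = real M * k \<longrightarrow>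
      3 * (L2norm (fourier_proj N u0))\<^sup>2 * k * real N < 1 \<longrightarrow>
      semidiscrete_solution s N T u0 uN \<longrightarrow>
      (\<forall>n<M. midpoint_step s N k (uN (real n * k)) (Z n)) \<longrightarrow>
      (MAX n\<in>{..<M}. L2norm (\<lambda>x. uN (real (Suc n) * k) x - Z n x)) \<le> C * k ^ 3"
  proof (intro exI[of _ C] allI impI)
    fix N M :: nat and k :: real and uN :: "real \<Rightarrow> real \<Rightarrow> complex" and Z :: "nat \<Rightarrow> real \<Rightarrow> complex"
    assume N: "1 \<le> N" and k: "0 < k" and TM: "T = real M * k"
      and cfl: "3 * (L2norm (fourier_proj N u0))\<^sup>2 * k * real N < 1"
      and semi: "semidiscrete_solution s N T u0 uN"
      and Z: "\<forall>n<M. midpoint_step s N k (uN (real n * k)) (Z n)"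
    let ?I = "{- int N..int N}"
    define c where "c t = fourier_coeff (uN t)" for t
    note cs = semidiscrete_solution_coeffs[OF semi T, folded c_def]
    have bc: "weight_bounded N 8 K (c t)" if "t \<in> {0..T}" for t
      unfolding c_def by (rule reg[OF N semi that])
    obtain c2 c3 where d: "\<And>t j. t \<in> {0..T} \<Longrightarrow> j \<in> ?I \<Longrightarrow>
          ((\<lambda>\<tau>. flow s N (c \<tau>) j) has_vector_derivative c2 t j) (at t within {0..T})"
        "\<And>t j. t \<in> {0..T} \<Longrightarrow> j \<in> ?I \<Longrightarrow>
          ((\<lambda>\<tau>. c2 \<tau> j) has_vector_derivative c3 t j) (at t within {0..T})"
      and b1: "\<And>t. t \<in> {0..T} \<Longrightarrow> weight_bounded N 6 L (flow s N (c t))"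
      and b3: "\<And>t. t \<in> {0..T} \<Longrightarrow> weight_bounded N 2 L (c3 t)"
      using der[of T N c] cs(2) bc by blast
    define m where "m = (\<Sum>j\<in>?I. (cmod (c 0 j))\<^sup>2)"
    have mass: "(\<Sum>j\<in>?I. (cmod (c t j))\<^sup>2) = m" if "t \<in> {0..T}" for t
      unfolding m_def by (rule flow_mass_conserved[OF cs(2) that])
    have cfl': "3 * (2 * pi * m) * k * real N < 1"
    proof -
      have "fourier_proj N u0 = trig_poly N (c 0)"
        unfolding fourier_proj_eq by (rule trig_poly_cong) (simp add: cs(3))
      hence "(L2norm (fourier_proj N u0))\<^sup>2 = 2 * pi * m"
        by (simp add: L2norm_trig_poly m_def sum_nonneg)
      thus ?thesis using cfl by simp
    qed
    \<comment> \<open>The maximum is thereby taken over a nonempty set.\<close>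
    have M: "M \<noteq> 0"
    proof
      assume "M = 0"
      thus False using T TM by simp
    qed
    have step: "L2norm (\<lambda>x. uN (real (Suc n) * k) x - Z n x) \<le> C * k ^ 3" if n: "n < M" for n
    proof -
      define a where "a = real n * k"
      define b where "b = real (Suc n) * k"
      have ab: "b - a = k" by (simp add: a_def b_def algebra_simps)
      have "b \<le> T" unfolding b_def TM using n k by (intro mult_right_mono) auto
      moreover have "0 \<le> a" using k by (simp add: a_def)
      \<comment> \<open>As \<open>n < M\<close>, the whole step lies in \<open>{0..T}\<close>, and
        the one-sided derivatives there restrict to \<open>{a..b}\<close>.\<close>
      ultimately have sub: "{a..b} \<subseteq> {0..T}" and aT: "a \<in> {0..T}" and bT: "b \<in> {0..T}" using ab k by auto
      have abm: "a \<in> {a..b}" "b \<in> {a..b}" using ab k by auto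
      obtain z where z: "Z n = trig_poly N z"
        "\<And>j. j \<in> ?I \<Longrightarrow> z j = c a j + of_real k * flow s N (\<lambda>j. (z j + c a j) / 2) j"
        using midpoint_step_coeffs[of s N k "c a" "Z n"] Z n cs(1)[OF aT] by (metis a_def)
      \<comment> \<open>The defect of the exact semidiscrete solution in the trapezoidal
        rule.\<close>
      define \<rho> where "\<rho> j = c b j - c a j - ((b - a) / 2) *\<^sub>R (flow s N (c a) j + flow s N (c b) j)" for j
      have "(\<Sum>j\<in>?I. (cmod (c b j - z j))\<^sup>2) \<le> 4 * ((81 / 4 * K * L\<^sup>2)\<^sup>2 + 3 * (L / 2)\<^sup>2) * k ^ 6"
      proof (rule midpoint_local_error[OF N k K L _ z(2) mass[OF aT] mass[OF bT] cfl' bc[OF aT] bc[OF bT]])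
        show "c b j = c a j + of_real (k / 2) * (flow s N (c a) j + flow s N (c b) j) + \<rho> j" for j
          by (simp add: \<rho>_def ab scaleR_conv_of_real)
        show "weight_bounded N 6 (L * k) (\<lambda>j. c b j - c a j)"
          unfolding weight_bounded_def
        proof
          fix j assume j: "j \<in> ?I"
          have "cmod (c b j - c a j) \<le> (L * weight 6 j) * \<bar>b - a\<bar>"
          proof (rule norm_diff_le_vector_derivative[of a b _ "\<lambda>t. flow s N (c t) j"])
            fix t assume t: "t \<in> {a..b}"
            show "((\<lambda>t. c t j) has_vector_derivative flow s N (c t) j) (at t within {a..b})"
              by (rule has_vector_derivative_within_subset[OF cs(2)[OF subsetD[OF sub t] j] sub])
            show "cmod (flow s N (c t) j) \<le> L * weight 6 j"
              using b1[OF subsetD[OF sub t]] j by (auto simp: weight_bounded_def)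
          qed (use abm in auto)
          thus "cmod (c b j - c a j) \<le> L * k * weight 6 j" using k by (simp add: ab mult_ac)
        qed
        show "weight_bounded N 2 (L / 2 * k ^ 3) \<rho>"
          unfolding weight_bounded_def
        proof
          fix j assume j: "j \<in> ?I"
          have "cmod (\<rho> j) \<le> (L * weight 2 j) * (b - a) ^ 3 / 2"
            unfolding \<rho>_def
          proof (rule trapezoidal_remainder[of a b _ "\<lambda>t. flow s N (c t) j" "\<lambda>t. c2 t j" "\<lambda>t. c3 t j"])
            fix t assume t: "t \<in> {a..b}"
            note tT = subsetD[OF sub t]
            show "((\<lambda>t. c t j) has_vector_derivative flow s N (c t) j) (at t within {a..b})"
              "((\<lambda>t. flow s N (c t) j) has_vector_derivative c2 t j) (at t within {a..b})"
              "((\<lambda>t. c2 t j) has_vector_derivative c3 t j) (at t within {a..b})"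
              by (rule has_vector_derivative_within_subset[OF _ sub], rule cs(2) d, rule tT, rule j)+
            show "cmod (c3 t j) \<le> L * weight 2 j"
              using b3[OF tT] j by (auto simp: weight_bounded_def)
          qed (use abm in auto)
          thus "cmod (\<rho> j) \<le> L / 2 * k ^ 3 * weight 2 j" by (simp add: ab mult_ac)
        qed
      qed
      hence "2 * pi * (\<Sum>j\<in>?I. (cmod (c b j - z j))\<^sup>2) \<le>
          2 * pi * (4 * ((81 / 4 * K * L\<^sup>2)\<^sup>2 + 3 * (L / 2)\<^sup>2) * k ^ 6)"
        by (rule mult_left_mono) simp
      also have "\<dots> = (2 * pi * (4 * ((81 / 4 * K * L\<^sup>2)\<^sup>2 + 3 * (L / 2)\<^sup>2))) * (k ^ 3)\<^sup>2"
        by (simp add: power_mult[symmetric])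
      finally have "sqrt (2 * pi * (\<Sum>j\<in>?I. (cmod (c b j - z j))\<^sup>2)) \<le>
          sqrt ((2 * pi * (4 * ((81 / 4 * K * L\<^sup>2)\<^sup>2 + 3 * (L / 2)\<^sup>2))) * (k ^ 3)\<^sup>2)"
        by (rule real_sqrt_le_mono)
      also have "\<dots> = C * k ^ 3"
        unfolding C_def real_sqrt_mult[of _ "(k ^ 3)\<^sup>2"] using k by (subst real_sqrt_abs) simp
      finally have "sqrt (2 * pi * (\<Sum>j\<in>?I. (cmod (c b j - z j))\<^sup>2)) \<le> C * k ^ 3" .
      moreover have "(\<lambda>x. uN b x - Z n x) = trig_poly N (\<lambda>j. c b j - z j)"
        unfolding cs(1)[OF bT] z(1) trig_poly_diff ..
      ultimately show ?thesis by (simp add: L2norm_trig_poly b_def)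
    qed
    show "(MAX n\<in>{..<M}. L2norm (\<lambda>x. uN (real (Suc n) * k) x - Z n x)) \<le> C * k ^ 3"
      by (rule Max.boundedI) (use M step in auto)
  qed
qed

end
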